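(* Let $n\ge1$ and $m\ge 2$ be integers and let $p\ge 1$ be real. The polylinear (i.e. $m$-linear) operator $\beta:\bigotimes_{j=1}^m H^p(\mathbf U^n)\to A^p_{\mathbf{m-2}}(\mathbf U^n)$ defined by $$\beta(f_1,\dots,f_m)=\prod_{j=1}^m f_j$$ has norm one.
   Context: $\mathbf U$ is the open unit disc in $\mathbf C$, $\mathbf T=\partial\mathbf U$; $\mathbf U^n$ and $\mathbf T^n$ are the unit polydisc and its distinguished boundary, and $m_n$ is the normalized Haar measure on $\mathbf T^n$. For $p>0$, $H^p(\mathbf U^n)$ is the space of holomorphic functions $f$ on $\mathbf U^n$ with $\|f\|_{H^p(\mathbf U^n)}=\left(\sup_{0\le r<1}\int_{\mathbf T^n}|f(r\omega)|^p\,dm_n(\omega)\right)^{1/p}<\infty$. The measure $\mu_{\mathbf{m-2}}$ on $\mathbf U^n$ is $$d\mu_{\mathbf{m-2}}(z)=\frac{(m-1)^n}{\pi^n}\prod_{k=1}^n(1-|z_k|^2)^{m-2}\,dx_k\,dy_k,\qquad z_k=x_k+iy_k ,$$ and $A^p_{\mathbf{m-2}}(\mathbf U^n)$ is the weighted Bergman space of holomorphic functions $f$ on $\mathbf U^n$ with $\|f\|_{A^p_{\mathbf{m-2}}(\mathbf U^n)}=\left(\int_{\mathbf U^n}|f|^p\,d\mu_{\mathbf{m-2}}\right)^{1/p}<\infty$. The norm of the $m$-linear operator $\beta$ is the supremum of $\|\beta(f_1,\dots,f_m)\|_{A^p_{\mathbf{m-2}}(\mathbf U^n)}/\prod_{j=1}^m\|f_j\|_{H^p(\mathbf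 U^n)}$ over all nonzero $f_1,\dots,f_m\in H^p(\mathbf U^n)$. *)

theory Defs
  imports "HOL-Analysis.Analysis"
begin

definition polydisc :: "(complex ^ 'n) set" where
  "polydisc = {z. \<forall>k. norm (z $ k) < 1}"

definition torus :: "(complex ^ 'n) set" where
  "torus = {z. \<forall>k. norm (z $ k) = 1}"

(* Normalized Haar measure on the torus: the image of normalized Lebesgue measure on
   [0, 2 pi]^n under (t_1, ..., t_n) |-> (exp (i t_1), ..., exp (i t_n)). *)
definition torus_measure :: "(complex ^ 'n) measure" where
  "torus_measure =
     distr (uniform_measure lborel (cbox 0 (\<chi> k. 2 * pi) :: (real ^ 'n) set))
       (restrict_space borel torus) (\<lambda>t. \<chi> k. cis (t $ k))"

(* The library's holomorphic_on covers one variable only. In several variables, on an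
   open set: the Frechet derivative exists everywhere and is complex linear. *)
definition holomorphic_vec_on :: "(complex ^ 'n \<Rightarrow> complex) \<Rightarrow> (complex ^ 'n) set \<Rightarrow> bool" where
  "holomorphic_vec_on f S \<longleftrightarrow>
     (\<forall>z\<in>S. \<exists>D. (f has_derivative D) (at z within S) \<and> (\<forall>c v. D (c *s v) = c * D v))"

definition hardy_mean :: "real \<Rightarrow> (complex ^ 'n \<Rightarrow> complex) \<Rightarrow> ennreal" where
  "hardy_mean p f =
     (SUP r\<in>{0..<1::real}. \<integral>\<^sup>+ w. ennreal (norm (f (r *\<^sub>R w)) powr p) \<partial>torus_measure)"

(* Only the values on the polydisc matter, here and in the Bergman spaces below. *)
definition hardy_space :: "real \<Rightarrow> (complex ^ 'n \<Rightarrow> complex) set" where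
  "hardy_space p = {f. holomorphic_vec_on f polydisc \<and> hardy_mean p f < \<infinity>}"

(* Meaningful on hardy_space p only: enn2real maps infinity to 0. *)
definition hardy_norm :: "real \<Rightarrow> (complex ^ 'n \<Rightarrow> complex) \<Rightarrow> real" where
  "hardy_norm p f = enn2real (hardy_mean p f) powr (1 / p)"

(* Indexed by m, the weight exponent being m - 2; meant for m >= 2. Here lborel on
   complex ^ 'n is Lebesgue measure in the real coordinates x_k, y_k. *)
definition bergman_measure :: "nat \<Rightarrow> (complex ^ 'n) measure" where
  "bergman_measure m =
     density (restrict_space lborel polydisc)
       (\<lambda>z. ennreal ((real m - 1) ^ CARD('n) / pi ^ CARD('n) *
                     (\<Prod>k\<in>UNIV. (1 - (norm (z $ k))\<^sup>2) ^ (m - 2))))"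

definition bergman_integral :: "nat \<Rightarrow> real \<Rightarrow> (complex ^ 'n \<Rightarrow> complex) \<Rightarrow> ennreal" where
  "bergman_integral m p f = (\<integral>\<^sup>+ z. ennreal (norm (f z) powr p) \<partial>bergman_measure m)"

definition bergman_space :: "nat \<Rightarrow> real \<Rightarrow> (complex ^ 'n \<Rightarrow> complex) set" where
  "bergman_space m p = {f. holomorphic_vec_on f polydisc \<and> bergman_integral m p f < \<infinity>}"

(* Meaningful on bergman_space m p only, as for hardy_norm. *)
definition bergman_norm :: "nat \<Rightarrow> real \<Rightarrow> (complex ^ 'n \<Rightarrow> complex) \<Rightarrow> real" where
  "bergman_norm m p f = enn2real (bergman_integral m p f) powr (1 / p)"

(* The arguments of an m-linear operator are f 0, ..., f (m - 1). *)
definition polylinear_operator ::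
  "nat \<Rightarrow> ('a \<Rightarrow> complex) set \<Rightarrow> ('b \<Rightarrow> complex) set \<Rightarrow>
     ((nat \<Rightarrow> 'a \<Rightarrow> complex) \<Rightarrow> 'b \<Rightarrow> complex) \<Rightarrow> bool" where
  "polylinear_operator m V W B \<longleftrightarrow>
     (\<forall>f. (\<forall>j<m. f j \<in> V) \<longrightarrow> B f \<in> W) \<and>
     (\<forall>f i g h a b. (\<forall>j<m. f j \<in> V) \<and> i < m \<and> g \<in> V \<and> h \<in> V \<longrightarrow>
        B (f(i := \<lambda>z. a * g z + b * h z)) =
          (\<lambda>z. a * B (f(i := g)) z + b * B (f(i := h)) z))"

(* The supremum is taken in ennreal, where it exists without a boundedness hypothesis. *)
definition hardy_bergman_operator_norm ::
  "nat \<Rightarrow> real \<Rightarrow> ((nat \<Rightarrow> complex ^ 'n \<Rightarrow> complex) \<Rightarrow> complex ^ 'n \<Rightarrow> complex) \<Rightarrow> ennreal" where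
  "hardy_bergman_operator_norm m p B =
     (SUP f\<in>{f. \<forall>j<m. f j \<in> hardy_space p \<and> (\<exists>z\<in>polydisc. f j z \<noteq> 0)}.
        ennreal (bergman_norm m p (B f) / (\<Prod>j<m. hardy_norm p (f j))))"

definition product_operator ::
  "nat \<Rightarrow> (nat \<Rightarrow> complex ^ 'n \<Rightarrow> complex) \<Rightarrow> complex ^ 'n \<Rightarrow> complex" where
  "product_operator m f = (\<lambda>z. \<Prod>j<m. f j z)"

end

theory Submission
  imports Defs "HOL-Complex_Analysis.Conformal_Mappings"
begin

text \<open>The heart of the matter is the inequality
  \<open>\<integral>\<^sup>+z. \<Prod>j<m. |f j z| powr p \<partial>\<mu> \<le> \<Prod>j<m. hardy_mean p (f j)\<close>
  with \<open>\<mu>\<close> the Bergman measure on the polydisc (\<open>bergman_integral_product_le\<close>). It says that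
  products of Hardy functions lie in the Bergman space and that the norm is at most one. Both
  measures are probability measures, so the constant function one shows that the norm is not
  smaller.

  In one variable and for \<open>p = 2\<close> both sides can be read off from Taylor coefficients. The squared
  Bergman norm of the monomial of degree \<open>k\<close> is \<open>1 / ((k + m - 1) choose k)\<close>, and the binomial
  coefficient counts the ways to write \<open>k\<close> as an ordered sum of \<open>m\<close> natural numbers, that is, the
  terms of the coefficient of degree \<open>k\<close> in a product of \<open>m\<close> series. So the inequality
  (\<open>Bergman_Hardy_inequality_power_series\<close>) is Cauchy--Schwarz in each degree. For general
  \<open>p > 0\<close> the zeros in the disc are removed by Blaschke factors, which keeps the modulus on the circle
  and can only increase it inside (\<open>zero_free_majorant\<close>). The zero-free function then has a
  holomorphic power with exponent \<open>p / 2\<close>, which brings back the case \<open>p = 2\<close>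
  (\<open>Bergman_Hardy_inequality_one_variable\<close>).

  In several variables zeros cannot be divided out. But the torus measure and the Bergman measure
  are products of their one-variable versions, and a bound of the integral of a product by a product
  of integrals tensorizes by Tonelli's theorem (\<open>product_inequality_tensorizes\<close>): after the
  one-variable inequality in one coordinate, each factor has its own variable on the circle, and for
  fixed values of these the factors are again holomorphic in the other coordinates.

  Boundary values are avoided throughout: everything is proved for dilated functions, which are
  holomorphic beyond the closed polydisc, and Fatou's lemma removes the dilation.\<close>

section \<open>Coefficients of products of power series\<close>

text \<open>The weights \<open>(i + n) choose i\<close> are the Taylor coefficients of \<open>(1 - x)\<close> to the power
  \<open>- (n + 1)\<close>, and partial sums of coefficients correspond to one more factor
  \<open>1 / (1 - x)\<close>. This is how the weights change when a product of power series gets one more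
  factor.\<close>
lemma sum_choose_diagonal: "(\<Sum>i\<le>k. (i + n) choose i) = (k + Suc n) choose k"
  by (induction k) (auto)

text \<open>Cauchy--Schwarz, with \<open>a i * b (k - i)\<close> split as \<open>sqrt (w i)\<close> times the rest.\<close>
lemma weighted_Cauchy_product_bound:
  fixes a b :: "nat \<Rightarrow> complex" and w :: "nat \<Rightarrow> real"
  assumes w: "\<And>i. w i > 0"
  shows "(norm (\<Sum>i\<le>k. a i * b (k - i)))\<^sup>2 / (\<Sum>i\<le>k. w i)
           \<le> (\<Sum>i\<le>k. (norm (a i))\<^sup>2 / w i * (norm (b (k - i)))\<^sup>2)"
proof -
  have W: "(\<Sum>i\<le>k. w i) > 0" using w by (intro sum_pos) auto
  have "norm (\<Sum>i\<le>k. a i * b (k - i)) \<le> (\<Sum>i\<le>k. norm (a i) * norm (b (k - i)))"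
    by (rule order_trans[OF norm_sum]) (simp add: norm_mult)
  also have "\<dots> = (\<Sum>i\<le>k. sqrt (w i) * (norm (a i) * norm (b (k - i)) / sqrt (w i)))"
    by (rule sum.cong) (use w less_imp_neq in \<open>force simp: field_simps\<close>)+
  finally have "(norm (\<Sum>i\<le>k. a i * b (k - i)))\<^sup>2
      \<le> (\<Sum>i\<le>k. sqrt (w i) * (norm (a i) * norm (b (k - i)) / sqrt (w i)))\<^sup>2"
    by (rule power_mono) auto
  also have "\<dots> \<le> (\<Sum>i\<le>k. (sqrt (w i))\<^sup>2) * (\<Sum>i\<le>k. (norm (a i) * norm (b (k - i)) / sqrt (w i))\<^sup>2)"
    by (rule Cauchy_Schwarz_ineq_sum)
  also have "\<dots> = (\<Sum>i\<le>k. w i) * (\<Sum>i\<le>k. (norm (a i))\<^sup>2 / w i * (norm (b (k - i)))\<^sup>2)"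
    using w by (simp add: power_divide power_mult_distrib less_imp_le)
  finally show ?thesis using W by (simp add: field_simps)
qed

lemma summable_norm_square:
  fixes a :: "nat \<Rightarrow> complex"
  assumes "summable (\<lambda>k. norm (a k))"
  shows "summable (\<lambda>k. (norm (a k))\<^sup>2)"
proof -
  have "eventually (\<lambda>k. norm (a k) < 1) sequentially"
    using summable_LIMSEQ_zero[OF assms] by (intro order_tendstoD) auto
  then have "eventually (\<lambda>k. norm ((norm (a k))\<^sup>2) \<le> norm (a k)) sequentially"
    by eventually_elim (simp add: power2_eq_square mult_left_le)
  then show ?thesis using assms by (rule summable_comparison_test_ev)
qed

text \<open>Up to the weights, this bounds the norm of a product of \<open>n + 1\<close> functions in \<open>H\<^sup>2\<close>
  by the product of their norms; \<open>c\<close> is the coefficient sequence of the product. In the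
  induction step, Cauchy--Schwarz is applied with the binomial coefficients for \<open>n\<close> as weights.
  Their partial sums are the binomial coefficients for \<open>n + 1\<close>, and what remains on the right is
  a Cauchy product of two convergent series of nonnegative terms.\<close>
lemma product_power_series_bound:
  fixes a :: "nat \<Rightarrow> nat \<Rightarrow> complex"
  assumes a: "\<And>j. j \<le> n \<Longrightarrow> summable (\<lambda>k. norm (a j k))"
  shows "\<exists>c. summable (\<lambda>k. norm (c k)) \<and>
     (\<forall>z. norm z \<le> 1 \<longrightarrow> (\<Prod>j\<le>n. \<Sum>k. a j k * z ^ k) = (\<Sum>k. c k * z ^ k)) \<and>
     summable (\<lambda>k. (norm (c k))\<^sup>2 / real ((k + n) choose k)) \<and>
     (\<Sum>k. (norm (c k))\<^sup>2 / real ((k + n) choose k)) \<le> (\<Prod>j\<le>n. \<Sum>k. (norm (a j k))\<^sup>2)"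
  using assms
proof (induction n)
  case 0
  then show ?case by (intro exI[of _ "a 0"]) (auto intro: summable_norm_square)
next
  case (Suc n)
  have "\<And>j. j \<le> n \<Longrightarrow> summable (\<lambda>k. norm (a j k))" using Suc.prems by simp
  from Suc.IH[OF this] obtain c where c: "summable (\<lambda>k. norm (c k))"
     "\<And>z. norm z \<le> 1 \<Longrightarrow> (\<Prod>j\<le>n. \<Sum>k. a j k * z ^ k) = (\<Sum>k. c k * z ^ k)"
     "summable (\<lambda>k. (norm (c k))\<^sup>2 / real ((k + n) choose k))"
     "(\<Sum>k. (norm (c k))\<^sup>2 / real ((k + n) choose k)) \<le> (\<Prod>j\<le>n. \<Sum>k. (norm (a j k))\<^sup>2)"
    by blast
  define b where "b = a (Suc n)"
  have b: "summable (\<lambda>k. norm (b k))" using Suc.prems b_def by auto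
  define d where "d k = (\<Sum>i\<le>k. c i * b (k - i))" for k
  let ?w = "\<lambda>k. real ((k + n) choose k)"
  have geom: "summable (\<lambda>k. norm (u k * z ^ k))" if "summable (\<lambda>k. norm (u k))" "norm z \<le> 1"
    for u :: "nat \<Rightarrow> complex" and z
    by (rule summable_comparison_test'[OF that(1), of 0])
       (use that(2) in \<open>auto simp: norm_mult norm_power mult_left_le power_le_one\<close>)
  have d1: "summable (\<lambda>k. norm (d k))"
  proof (rule summable_comparison_test'[of _ 0])
    show "summable (\<lambda>k. \<Sum>i\<le>k. norm (c i) * norm (b (k - i)))"
      using summable_Cauchy_product[of "\<lambda>k. norm (c k)" "\<lambda>k. norm (b k)"] c(1) b by simp
    show "norm (norm (d k)) \<le> (\<Sum>i\<le>k. norm (c i) * norm (b (k - i)))" for k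
      unfolding d_def by (simp, rule order_trans[OF norm_sum]) (simp add: norm_mult)
  qed
  have d2: "(\<Prod>j\<le>Suc n. \<Sum>k. a j k * z ^ k) = (\<Sum>k. d k * z ^ k)" if z: "norm z \<le> 1" for z
  proof -
    have "(\<Prod>j\<le>Suc n. \<Sum>k. a j k * z ^ k) = (\<Sum>k. c k * z ^ k) * (\<Sum>k. b k * z ^ k)"
      using c(2)[OF z] by (simp add: b_def)
    also have "\<dots> = (\<Sum>k. \<Sum>i\<le>k. (c i * z ^ i) * (b (k - i) * z ^ (k - i)))"
      by (rule Cauchy_product) (use geom c(1) b z in auto)
    also have "\<dots> = (\<Sum>k. d k * z ^ k)"
    proof (rule arg_cong[where f = suminf], rule ext)
      fix k
      have "(c i * z ^ i) * (b (k - i) * z ^ (k - i)) = c i * b (k - i) * z ^ k" if "i \<le> k" for i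
        using that by (simp add: power_add[symmetric])
      then show "(\<Sum>i\<le>k. (c i * z ^ i) * (b (k - i) * z ^ (k - i))) = d k * z ^ k"
        unfolding d_def sum_distrib_right by (intro sum.cong) auto
    qed
    finally show ?thesis .
  qed
  have b2: "summable (\<lambda>k. (norm (b k))\<^sup>2)" using b by (rule summable_norm_square)
  have prod_sums: "(\<lambda>k. \<Sum>i\<le>k. (norm (c i))\<^sup>2 / ?w i * (norm (b (k - i)))\<^sup>2) sums
      ((\<Sum>k. (norm (c k))\<^sup>2 / ?w k) * (\<Sum>k. (norm (b k))\<^sup>2))"
    by (rule Cauchy_product_sums) (use c(3) b2 in auto)
  have bound: "(norm (d k))\<^sup>2 / real ((k + Suc n) choose k)
      \<le> (\<Sum>i\<le>k. (norm (c i))\<^sup>2 / ?w i * (norm (b (k - i)))\<^sup>2)" for k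
  proof -
    have "real ((k + Suc n) choose k) = (\<Sum>i\<le>k. ?w i)"
      by (simp only: sum_choose_diagonal[symmetric] of_nat_sum)
    then show ?thesis
      unfolding d_def using weighted_Cauchy_product_bound[of ?w c b k] by simp
  qed
  have d3: "summable (\<lambda>k. (norm (d k))\<^sup>2 / real ((k + Suc n) choose k))"
    by (rule summable_comparison_test'[OF sums_summable[OF prod_sums], of 0]) (use bound in auto)
  have "(\<Sum>k. (norm (d k))\<^sup>2 / real ((k + Suc n) choose k))
      \<le> (\<Sum>k. (norm (c k))\<^sup>2 / ?w k) * (\<Sum>k. (norm (b k))\<^sup>2)"
    using suminf_le[OF bound d3 sums_summable[OF prod_sums]] sums_unique[OF prod_sums] by simp
  also have "\<dots> \<le> (\<Prod>j\<le>n. \<Sum>k. (norm (a j k))\<^sup>2) * (\<Sum>k. (norm (b k))\<^sup>2)"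
    by (intro mult_right_mono c(4) suminf_nonneg b2) auto
  finally show ?case
    using d1 d2 d3 by (intro exI[of _ d]) (simp add: b_def)
qed

section \<open>Circle averages\<close>

text \<open>Normalized arc length, in the form that makes the torus measure its power: a density on the
  parameter line, pushed forward by \<open>cis\<close>.\<close>
definition circle_measure :: "complex measure" where
  "circle_measure =
     distr (density lborel (\<lambda>t. ennreal (indicator {0..2*pi} t / (2*pi)))) borel cis"

lemma measurable_cis[measurable]: "cis \<in> borel_measurable borel"
  by (intro borel_measurable_continuous_onI continuous_intros)

lemma sets_circle_measure[simp, measurable_cong]: "sets circle_measure = sets borel"
  by (simp add: circle_measure_def)

lemma space_circle_measure[simp]: "space circle_measure = UNIV"
  by (simp add: circle_measure_def)

lemma emeasure_circle_measure: "emeasure circle_measure UNIV = 1"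
proof -
  have "emeasure circle_measure UNIV = (\<integral>\<^sup>+t. ennreal (1 / (2*pi)) * indicator {0..2*pi} t \<partial>lborel)"
    by (auto simp: circle_measure_def emeasure_distr emeasure_density indicator_def intro!: nn_integral_cong)
  also have "\<dots> = 1"
    by (subst nn_integral_cmult_indicator) (auto simp flip: ennreal_mult'')
  finally show ?thesis .
qed

lemma finite_circle_measure: "finite_measure circle_measure"
  by (rule finite_measureI) (simp add: emeasure_circle_measure)

lemma AE_circle_measure: "AE w in circle_measure. norm w = 1"
  unfolding circle_measure_def by (subst AE_distr_iff) auto

lemma integral_circle_power:
  "(\<integral>w. w ^ k * cnj w ^ l \<partial>circle_measure) = (if k = l then 1 else 0)"
proof -
  have [measurable]: "cnj \<in> borel_measurable borel"
    by (intro borel_measurable_continuous_onI continuous_intros)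
  have "(\<integral>w. w ^ k * cnj w ^ l \<partial>circle_measure)
      = (\<integral>t. (indicator {0..2*pi} t / (2*pi)) *\<^sub>R (cis t ^ k * cnj (cis t) ^ l) \<partial>lborel)"
    unfolding circle_measure_def by (simp add: integral_distr integral_density)
  also have "\<dots> = (\<integral>t. indicator {0..2*pi} t *\<^sub>R (cis ((real k - real l) * t) / (2*pi)) \<partial>lborel)"
    by (rule Bochner_Integration.integral_cong)
       (auto simp: Complex.DeMoivre cis_cnj cis_mult algebra_simps scaleR_conv_of_real)
  also have "\<dots> = (if k = l then 1 else 0)"
  proof (cases "k = l")
    case True
    then show ?thesis by (simp add: scaleR_conv_of_real)
  next
    case False
    define d where "d = real k - real l"
    let ?F = "\<lambda>t. cis (d * t) / (\<i> * d * (2*pi))"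
    have d: "d \<noteq> 0" using False by (simp add: d_def)
    have "has_bochner_integral lborel (\<lambda>t. indicator {0..2*pi} t *\<^sub>R (cis (d * t) / (2*pi)))
        (?F (2*pi) - ?F 0)"
    proof (rule has_bochner_integral_FTC_Icc)
      show "(0::real) \<le> 2 * pi" by simp
      fix t
      show "(?F has_vector_derivative cis (d * t) / (2*pi)) (at t within {0..2*pi})"
      proof -
        have "((\<lambda>t. cis (d * t)) has_vector_derivative (d *\<^sub>R (\<i> * cis (d * t)))) (at t within {0..2*pi})"
          unfolding has_vector_derivative_def
          by (auto intro!: derivative_eq_intros simp: scaleR_conv_of_real)
        then have "(?F has_vector_derivative (d *\<^sub>R (\<i> * cis (d * t))) / (\<i> * d * (2*pi))) (at t within {0..2*pi})"
          by (rule has_vector_derivative_divide)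
        then show ?thesis using d by (simp add: scaleR_conv_of_real field_simps)
      qed
    qed (intro continuous_intros, auto)
    moreover have "cis (d * (2*pi)) = 1"
      using cis_multiple_2pi[of d] by (simp add: mult_ac d_def)
    ultimately show ?thesis using False by (simp add: has_bochner_integral_iff d_def)
  qed
  finally show ?thesis .
qed

text \<open>For the partial sums the identity is orthonormality of the powers of \<open>w\<close>; absolute
  summability bounds them uniformly on the circle, so that dominated convergence applies.\<close>
lemma circle_Parseval:
  fixes a :: "nat \<Rightarrow> complex"
  assumes a: "summable (\<lambda>k. norm (a k))"
  shows "(\<integral>\<^sup>+ w. ennreal ((norm (\<Sum>k. a k * w ^ k))\<^sup>2) \<partial>circle_measure)
           = ennreal (\<Sum>k. (norm (a k))\<^sup>2)"
proof -
  interpret finite_measure circle_measure by (rule finite_circle_measure)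
  have [measurable]: "cnj \<in> borel_measurable borel"
    by (intro borel_measurable_continuous_onI continuous_intros)
  let ?s = "\<lambda>n w. \<Sum>k<n. a k * w ^ k"
  let ?A = "\<Sum>k. norm (a k)"
  have bound: "norm (?s n w) \<le> ?A" if "norm w = 1" for n w
  proof -
    have "norm (?s n w) \<le> (\<Sum>k<n. norm (a k))"
      using that by (intro order_trans[OF norm_sum]) (simp add: norm_mult norm_power)
    also have "\<dots> \<le> ?A" by (intro sum_le_suminf a) auto
    finally show ?thesis .
  qed
  have int_pow: "integrable circle_measure (\<lambda>w. w ^ k * cnj w ^ l)" for k l
    by (rule integrable_const_bound[where B = 1])
       (use AE_circle_measure in \<open>auto elim!: eventually_mono simp: norm_mult norm_power\<close>)
  have partial: "(\<integral>\<^sup>+ w. ennreal ((norm (?s n w))\<^sup>2) \<partial>circle_measure) = ennreal (\<Sum>k<n. (norm (a k))\<^sup>2)" for n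
  proof -
    have eq: "complex_of_real ((norm (?s n w))\<^sup>2)
        = (\<Sum>k<n. \<Sum>l<n. (a k * cnj (a l)) * (w ^ k * cnj w ^ l))" for w
      unfolding complex_norm_square by (simp add: sum_product cnj_sum mult_ac)
    have "of_real (\<integral>w. (norm (?s n w))\<^sup>2 \<partial>circle_measure)
        = (\<integral>w. complex_of_real ((norm (?s n w))\<^sup>2) \<partial>circle_measure)"
      by (rule integral_complex_of_real[symmetric])
    also have "\<dots> = (\<Sum>k<n. \<Sum>l<n. (a k * cnj (a l)) * (if k = l then 1 else 0))"
      unfolding eq by (simp add: int_pow integral_circle_power)
    also have "\<dots> = of_real (\<Sum>k<n. (norm (a k))\<^sup>2)"
      by (simp add: if_distrib[of "\<lambda>x. _ * x"] complex_norm_square cong: if_cong flip: of_real_power)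
    finally have I: "(\<integral>w. (norm (?s n w))\<^sup>2 \<partial>circle_measure) = (\<Sum>k<n. (norm (a k))\<^sup>2)"
      using of_real_eq_iff by blast
    have "integrable circle_measure (\<lambda>w. (norm (?s n w))\<^sup>2)"
      by (rule integrable_const_bound[where B = "?A\<^sup>2"])
         (use AE_circle_measure bound in \<open>auto elim!: eventually_mono intro!: power_mono\<close>)
    then show ?thesis by (subst nn_integral_eq_integral) (auto simp: I)
  qed
  have "(\<lambda>n. \<integral>\<^sup>+ w. ennreal ((norm (?s n w))\<^sup>2) \<partial>circle_measure)
      \<longlonglongrightarrow> (\<integral>\<^sup>+ w. ennreal ((norm (\<Sum>k. a k * w ^ k))\<^sup>2) \<partial>circle_measure)"
  proof (rule nn_integral_dominated_convergence[where w = "\<lambda>_. ennreal (?A\<^sup>2)"])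
    show "(\<integral>\<^sup>+ w. ennreal (?A\<^sup>2) \<partial>circle_measure) < \<infinity>"
      by (simp add: emeasure_circle_measure)
    show "AE w in circle_measure. ennreal ((norm (?s n w))\<^sup>2) \<le> ennreal (?A\<^sup>2)" for n
      using AE_circle_measure by eventually_elim (intro ennreal_leI power_mono bound, auto)
    show "AE w in circle_measure. (\<lambda>n. ennreal ((norm (?s n w))\<^sup>2))
        \<longlonglongrightarrow> ennreal ((norm (\<Sum>k. a k * w ^ k))\<^sup>2)"
      using AE_circle_measure
    proof eventually_elim
      fix w :: complex assume "norm w = 1"
      then have "summable (\<lambda>k. norm (a k * w ^ k))" using a by (simp add: norm_mult norm_power)
      then have "summable (\<lambda>k. a k * w ^ k)" by (rule summable_norm_cancel)
      then show "(\<lambda>n. ennreal ((norm (?s n w))\<^sup>2)) \<longlonglongrightarrow> ennreal ((norm (\<Sum>k. a k * w ^ k))\<^sup>2)"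
        by (intro tendsto_ennrealI tendsto_power tendsto_norm summable_LIMSEQ)
    qed
  qed auto
  moreover have "(\<lambda>n. ennreal (\<Sum>k<n. (norm (a k))\<^sup>2)) \<longlonglongrightarrow> ennreal (\<Sum>k. (norm (a k))\<^sup>2)"
    by (intro tendsto_ennrealI summable_LIMSEQ summable_norm_square a)
  ultimately show ?thesis unfolding partial by (rule LIMSEQ_unique)
qed

section \<open>Rotation invariance of planar Lebesgue measure\<close>

lemma measurable_Complex[measurable (raw)]:
  assumes [measurable]: "f \<in> borel_measurable M" "g \<in> borel_measurable M"
  shows "(\<lambda>x. Complex (f x) (g x)) \<in> borel_measurable M"
  unfolding Complex_eq by measurable

lemma lborel_complex: "lborel = distr (lborel \<Otimes>\<^sub>M lborel) borel (\<lambda>(x, y). Complex x y)"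
proof (rule lborel_eqI)
  fix l u :: complex
  assume le: "\<And>b. b \<in> Basis \<Longrightarrow> l \<bullet> b \<le> u \<bullet> b"
  then have "Re l \<le> Re u" "Im l \<le> Im u"
    using le[of 1] le[of \<i>] by (auto simp: Basis_complex_def inner_complex_def)
  moreover have "(\<lambda>(x, y). Complex x y) -` box l u \<inter> space (lborel \<Otimes>\<^sub>M lborel)
      = box (Re l) (Re u) \<times> box (Im l) (Im u)"
    by (auto simp: box_def Basis_complex_def inner_complex_def space_pair_measure)
  ultimately show "emeasure (distr (lborel \<Otimes>\<^sub>M lborel) borel (\<lambda>(x, y). Complex x y)) (box l u)
      = ennreal (\<Prod>b\<in>Basis. (u - l) \<bullet> b)"
    by (subst emeasure_distr)
       (auto simp: lborel.emeasure_pair_measure_Times Basis_complex_def inner_complex_def ennreal_mult)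
qed simp

lemma nn_integral_complex:
  assumes [measurable]: "F \<in> borel_measurable borel"
  shows "(\<integral>\<^sup>+z. F z \<partial>lborel) = (\<integral>\<^sup>+y. \<integral>\<^sup>+x. F (Complex x y) \<partial>lborel \<partial>lborel)"
    and "(\<integral>\<^sup>+z. F z \<partial>lborel) = (\<integral>\<^sup>+x. \<integral>\<^sup>+y. F (Complex x y) \<partial>lborel \<partial>lborel)"
proof -
  have eq: "(\<integral>\<^sup>+z. F z \<partial>lborel) = (\<integral>\<^sup>+z. F (Complex (fst z) (snd z)) \<partial>(lborel \<Otimes>\<^sub>M lborel))"
    by (subst lborel_complex, subst nn_integral_distr) (auto simp: case_prod_unfold)
  show "(\<integral>\<^sup>+z. F z \<partial>lborel) = (\<integral>\<^sup>+y. \<integral>\<^sup>+x. F (Complex x y) \<partial>lborel \<partial>lborel)"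
    unfolding eq by (subst lborel_pair.nn_integral_snd[symmetric]) auto
  show "(\<integral>\<^sup>+z. F z \<partial>lborel) = (\<integral>\<^sup>+x. \<integral>\<^sup>+y. F (Complex x y) \<partial>lborel \<partial>lborel)"
    unfolding eq by (subst lborel.nn_integral_fst[symmetric]) auto
qed

lemma nn_integral_shear:
  assumes [measurable]: "F \<in> borel_measurable borel"
  shows "(\<integral>\<^sup>+z. F (Complex (Re z + t * Im z) (Im z)) \<partial>lborel) = (\<integral>\<^sup>+z. F z \<partial>lborel)"
    and "(\<integral>\<^sup>+z. F (Complex (Re z) (Im z + t * Re z)) \<partial>lborel) = (\<integral>\<^sup>+z. F z \<partial>lborel)"
proof -
  have "(\<integral>\<^sup>+x. F (Complex x y) \<partial>lborel) = (\<integral>\<^sup>+x. F (Complex (x + t * y) y) \<partial>lborel)" for y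
    using nn_integral_real_affine[of "\<lambda>x. F (Complex x y)" 1 "t * y"] by (simp add: add.commute)
  then show "(\<integral>\<^sup>+z. F (Complex (Re z + t * Im z) (Im z)) \<partial>lborel) = (\<integral>\<^sup>+z. F z \<partial>lborel)"
    by (simp add: nn_integral_complex(1))
  have "(\<integral>\<^sup>+y. F (Complex x y) \<partial>lborel) = (\<integral>\<^sup>+y. F (Complex x (y + t * x)) \<partial>lborel)" for x
    using nn_integral_real_affine[of "\<lambda>y. F (Complex x y)" 1 "t * x"] by (simp add: add.commute)
  then show "(\<integral>\<^sup>+z. F (Complex (Re z) (Im z + t * Re z)) \<partial>lborel) = (\<integral>\<^sup>+z. F z \<partial>lborel)"
    by (simp add: nn_integral_complex(2))
qed

text \<open>A rotation is a composition of three shears, and a shear preserves Lebesgue measure by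
  translation invariance on lines. The shears degenerate for the half turn, which is the square of
  a quarter turn.\<close>
lemma nn_integral_rotate:
  fixes c :: complex
  assumes [measurable]: "F \<in> borel_measurable borel" and c: "norm c = 1"
  shows "(\<integral>\<^sup>+z. F (c * z) \<partial>lborel) = (\<integral>\<^sup>+z. F z \<partial>lborel)"
proof -
  have main: "(\<integral>\<^sup>+z. F (c * z) \<partial>lborel) = (\<integral>\<^sup>+z. F z \<partial>lborel)"
    if [measurable]: "F \<in> borel_measurable borel" and c: "norm c = 1" "Re c \<noteq> -1" for c F
  proof -
    define a b where "a = Re c" and "b = Im c"
    have ab: "a\<^sup>2 + b\<^sup>2 = 1" "1 + a \<noteq> 0"
      using c unfolding a_def b_def by (auto simp: cmod_def add_eq_0_iff)
    \<comment> \<open>For \<open>c = cis \<theta>\<close> this is minus the tangent of \<open>\<theta> / 2\<close>.\<close>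
    define t where "t = - (b / (1 + a))"
    have t: "t * (1 + a) = - b" using ab by (simp add: t_def)
    have "(1 + t * b) * (1 + a) = a * (1 + a)"
    proof -
      have "(1 + t * b) * (1 + a) = 1 + a + b * (t * (1 + a))" by (simp add: algebra_simps)
      also have "\<dots> = 1 + a - b\<^sup>2" unfolding t by (simp add: power2_eq_square)
      also have "\<dots> = a * (1 + a)" using ab(1) by (simp add: algebra_simps power2_eq_square)
      finally show ?thesis .
    qed
    then have tb: "1 + t * b = a" using ab by simp
    let ?H = "\<lambda>z. Complex (Re z + t * Im z) (Im z)"
    let ?V = "\<lambda>z. Complex (Re z) (Im z + b * Re z)"
    have eq: "?H (?V (?H z)) = c * z" for z
    proof (rule complex_eqI)
      have "Re (?H (?V (?H z))) = (1 + t * b) * Re z + (t * (1 + (1 + t * b))) * Im z"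
        by (simp add: algebra_simps)
      then show "Re (?H (?V (?H z))) = Re (c * z)"
        unfolding tb t by (simp add: a_def b_def)
      have "Im (?H (?V (?H z))) = b * Re z + (1 + t * b) * Im z"
        by (simp add: algebra_simps)
      then show "Im (?H (?V (?H z))) = Im (c * z)"
        unfolding tb by (simp add: a_def b_def)
    qed
    have "(\<integral>\<^sup>+z. F (c * z) \<partial>lborel) = (\<integral>\<^sup>+z. F (?H (?V (?H z))) \<partial>lborel)"
      by (simp only: eq)
    also have "\<dots> = (\<integral>\<^sup>+z. F (?H (?V z)) \<partial>lborel)"
      by (rule nn_integral_shear(1)[of "\<lambda>z. F (?H (?V z))" t]) measurable
    also have "\<dots> = (\<integral>\<^sup>+z. F (?H z) \<partial>lborel)"
      by (rule nn_integral_shear(2)[of "\<lambda>z. F (?H z)" b]) measurable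
    also have "\<dots> = (\<integral>\<^sup>+z. F z \<partial>lborel)"
      by (rule nn_integral_shear(1)) measurable
    finally show ?thesis .
  qed
  show ?thesis
  proof (cases "Re c = -1")
    case False
    then show ?thesis using main[of F c] c by simp
  next
    case True
    then have "c = \<i> * \<i>"
      using c by (auto simp: complex_eq_iff cmod_def)
    then have "(\<integral>\<^sup>+z. F (c * z) \<partial>lborel) = (\<integral>\<^sup>+z. F (\<i> * (\<i> * z)) \<partial>lborel)"
      by (simp add: mult.assoc)
    also have "\<dots> = (\<integral>\<^sup>+z. F z \<partial>lborel)"
      using main[of "\<lambda>z. F (\<i> * z)" \<i>] main[of F \<i>] by simp
    finally show ?thesis .
  qed
qed

section \<open>The weighted disc and exponent two\<close>

definition disc_weight :: "nat \<Rightarrow> complex \<Rightarrow> ennreal" where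
  "disc_weight m z = ennreal ((real m - 1) / pi * (1 - (norm z)\<^sup>2) ^ (m - 2)) * indicator (ball 0 1) z"

definition disc_measure :: "nat \<Rightarrow> complex measure" where
  "disc_measure m = density lborel (disc_weight m)"

lemma measurable_unit_ball[measurable]: "ball (0::complex) 1 \<in> sets borel"
  by simp

lemma measurable_disc_weight[measurable]: "disc_weight m \<in> borel_measurable borel"
  unfolding disc_weight_def by measurable

lemma sets_disc_measure[simp, measurable_cong]: "sets (disc_measure m) = sets borel"
  by (simp add: disc_measure_def)

lemma space_disc_measure[simp]: "space (disc_measure m) = UNIV"
  by (simp add: disc_measure_def)

text \<open>A disc of radius \<open>sqrt t\<close> has area \<open>pi * t\<close>, so the square of the modulus is uniformly
  distributed. This replaces polar coordinates for radial integrals.\<close>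
lemma distr_square_norm_disc:
  "distr (density lborel (indicator (ball 0 1))) borel (\<lambda>z::complex. (norm z)\<^sup>2)
     = density lborel (\<lambda>t. ennreal pi * indicator {0..1} t)" (is "?M = ?N")
proof (rule measure_eqI_lessThan)
  have cball: "emeasure lborel (cball (0::complex) r) = ennreal (pi * r\<^sup>2)" if "r \<ge> 0" for r
    using emeasure_cball[OF that, of "0::complex"] by (simp add: eval_unit_ball_vol)
  have ball: "emeasure lborel (ball (0::complex) 1) = ennreal pi"
    using emeasure_ball[of 1 "0::complex"] by (simp add: eval_unit_ball_vol)
  have M: "emeasure ?M {x<..} = emeasure lborel (ball (0::complex) 1 \<inter> {z. (norm z)\<^sup>2 > x})" for x
    by (subst emeasure_distr, simp, simp, subst emeasure_density)
       (auto intro!: arg_cong2[where f = emeasure] simp: vimage_def simp flip: indicator_inter_arith nn_integral_indicator)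
  have N: "emeasure ?N {x<..} = ennreal pi * emeasure lborel ({0..1} \<inter> {x<..})" for x
    by (subst emeasure_density) (auto simp: mult.assoc nn_integral_cmult simp flip: indicator_inter_arith)
  show eq: "emeasure ?M {x<..} = emeasure ?N {x<..}" for x
  proof -
    consider "x < 0" | "0 \<le> x" "x < 1" | "1 \<le> x" by linarith
    then show ?thesis
    proof cases
      case 1
      then have "ball (0::complex) 1 \<inter> {z. (norm z)\<^sup>2 > x} = ball 0 1" "{0..1} \<inter> {x<..} = {0..1}"
        by (auto intro: less_le_trans)
      then show ?thesis by (simp add: M N ball)
    next
      case 2
      have iff: "sqrt x < norm z \<longleftrightarrow> x < (norm z)\<^sup>2" for z :: complex
        using real_sqrt_less_iff[of x "(norm z)\<^sup>2"] by simp
      have "ball (0::complex) 1 \<inter> {z. (norm z)\<^sup>2 > x} = ball 0 1 - cball 0 (sqrt x)"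
        unfolding iff[symmetric] by (rule set_eqI) (simp add: not_le)
      moreover have "emeasure lborel (ball 0 1 - cball (0::complex) (sqrt x)) = ennreal pi - ennreal (pi * x)"
      proof (subst emeasure_Diff)
        show "cball (0::complex) (sqrt x) \<subseteq> ball 0 1"
        proof
          fix z :: complex assume "z \<in> cball 0 (sqrt x)"
          then have "norm z \<le> sqrt x" by simp
          also have "sqrt x < 1" using 2 by simp
          finally show "z \<in> ball 0 1" by simp
        qed
      qed (use 2 in \<open>auto simp: ball cball\<close>)
      moreover have "{0..1} \<inter> {x<..} = {x<..1}" using 2 by auto
      ultimately show ?thesis
        using 2 by (simp add: M N ennreal_minus algebra_simps flip: ennreal_mult')
    next
      case 3
      have "\<not> x < (norm z)\<^sup>2" if "norm z < 1" for z :: complex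
        using that 3 power_le_one[of "norm z" 2] by (auto simp: not_less)
      then have "ball (0::complex) 1 \<inter> {z. (norm z)\<^sup>2 > x} = {}" by auto
      moreover have "{0..1} \<inter> {x<..} = {}" using 3 by auto
      ultimately show ?thesis by (simp only: M N) simp
    qed
  qed
  show "emeasure ?M {x<..} < \<infinity>" for x
  proof -
    have "emeasure ?M {x<..} \<le> emeasure lborel (ball (0::complex) 1)"
      unfolding M by (rule emeasure_mono) auto
    then show ?thesis by (simp add: ball le_less_trans)
  qed
qed auto

text \<open>The value is a Beta integral. It is the squared norm of the monomial of degree \<open>k\<close> in the
  weighted Bergman space, and exactly the weight of degree \<open>k\<close> in the coefficient bound for
  products of \<open>m\<close> power series.\<close>
lemma disc_moment:
  assumes m: "m \<ge> 2"
  shows "(\<integral>\<^sup>+z. ennreal ((norm z)\<^sup>2 ^ k) \<partial>disc_measure m) = ennreal (1 / real ((k + (m - 1)) choose k))"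
proof -
  define q where "q = m - 2"
  have m_eq: "m = q + 2" using m by (simp add: q_def)
  let ?f = "\<lambda>t::real. ennreal (t ^ k * ((real q + 1) / pi * (1 - t) ^ q))"
  have "(\<integral>\<^sup>+z. ennreal ((norm z)\<^sup>2 ^ k) \<partial>disc_measure m)
      = (\<integral>\<^sup>+z. ?f ((norm z)\<^sup>2) \<partial>density lborel (indicator (ball (0::complex) 1)))"
  proof -
    have "disc_weight m z * ennreal ((norm z)\<^sup>2 ^ k) = indicator (ball 0 1) z * ?f ((norm z)\<^sup>2)" for z
      by (cases "norm z < 1")
         (auto simp: disc_weight_def m_eq mult_ac power_le_one simp flip: ennreal_mult'')
    then show ?thesis
      by (simp add: disc_measure_def nn_integral_density)
  qed
  also have "\<dots> = (\<integral>\<^sup>+t. ?f t \<partial>density lborel (\<lambda>t. ennreal pi * indicator {0..1} t))"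
    unfolding distr_square_norm_disc[symmetric] by (subst nn_integral_distr) auto
  also have "\<dots> = (\<integral>\<^sup>+t\<in>{0..1}. ennreal ((real q + 1) * (t ^ k * (1 - t) ^ q)) \<partial>lborel)"
    by (subst nn_integral_density)
       (auto simp: indicator_def mult_ac simp flip: ennreal_mult' intro!: nn_integral_cong)
  also have "\<dots> = ennreal ((real q + 1) * Beta (real k + 1) (real q + 1))"
  proof (rule nn_integral_has_integral_lebesgue')
    have "((\<lambda>t. t powr (real k + 1 - 1) * (1 - t) powr (real q + 1 - 1))
        has_integral Beta (real k + 1) (real q + 1)) {0..1}"
      by (rule has_integral_Beta_real) auto
    \<comment> \<open>At the end points \<open>0 powr 0 = 0\<close> differs from \<open>0 ^ 0 = 1\<close>.\<close>
    then have "((\<lambda>t. t ^ k * (1 - t) ^ q) has_integral Beta (real k + 1) (real q + 1)) {0..1}"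
      by (rule has_integral_spike_finite[of "{0, 1}", rotated 2]) (auto simp: powr_realpow)
    then show "((\<lambda>t. (real q + 1) * (t ^ k * (1 - t) ^ q)) has_integral
        (real q + 1) * Beta (real k + 1) (real q + 1)) {0..1}"
      by (rule has_integral_mult_right)
  qed auto
  also have "(real q + 1) * Beta (real k + 1) (real q + 1) = 1 / real ((k + (m - 1)) choose k)"
  proof -
    have "Beta (real k + 1) (real q + 1) = fact k * fact q / fact (k + q + 1)"
      using Gamma_fact[of k, where 'a = real] Gamma_fact[of q, where 'a = real]
        Gamma_fact[of "k + q + 1", where 'a = real]
      by (simp add: Beta_def add_ac)
    moreover have "real ((k + (q + 1)) choose k) = fact (k + q + 1) / (fact k * fact (q + 1))"
      using binomial_fact[of k "k + (q + 1)", where 'a = real] by (simp add: add_ac)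
    ultimately show ?thesis by (simp add: m_eq algebra_simps)
  qed
  finally show ?thesis .
qed

lemma nn_integral_disc_rotate:
  assumes [measurable]: "F \<in> borel_measurable borel" and c: "norm c = 1"
  shows "(\<integral>\<^sup>+z. F (c * z) \<partial>disc_measure m) = (\<integral>\<^sup>+z. F z \<partial>disc_measure m)"
proof -
  have "disc_weight m (c * z) = disc_weight m z" for z
    using c by (simp add: disc_weight_def norm_mult indicator_def)
  then show ?thesis
    using nn_integral_rotate[of "\<lambda>z. disc_weight m z * F z" c] c
    by (simp add: disc_measure_def nn_integral_density)
qed

lemma emeasure_disc_measure: "m \<ge> 2 \<Longrightarrow> emeasure (disc_measure m) UNIV = 1"
  using disc_moment[of m 0] by simp

lemma finite_disc_measure: "m \<ge> 2 \<Longrightarrow> finite_measure (disc_measure m)"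
  by (rule finite_measureI) (simp add: emeasure_disc_measure)

lemma AE_disc_measure: "AE z in disc_measure m. norm z < 1"
  unfolding disc_measure_def by (subst AE_density) (auto simp: disc_weight_def indicator_def)

text \<open>The measure is rotation invariant, so the integrand may be averaged over rotations first. On each
  circle the average is given by Parseval's identity, and the remaining radial integrals are the
  moments.\<close>
lemma disc_power_series:
  fixes a :: "nat \<Rightarrow> complex"
  assumes a: "summable (\<lambda>k. norm (a k))" and m: "m \<ge> 2"
  shows "(\<integral>\<^sup>+z. ennreal ((norm (\<Sum>k. a k * z ^ k))\<^sup>2) \<partial>disc_measure m)
     = (\<Sum>k. ennreal ((norm (a k))\<^sup>2 / real ((k + (m - 1)) choose k)))"
proof -
  interpret A: finite_measure "disc_measure m" using m by (rule finite_disc_measure)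
  interpret B: finite_measure circle_measure by (rule finite_circle_measure)
  interpret AB: pair_sigma_finite "disc_measure m" circle_measure ..
  let ?H = "\<lambda>z. ennreal ((norm (\<Sum>k. a k * z ^ k))\<^sup>2)"
  have circle: "(\<integral>\<^sup>+w. ?H (w * z) \<partial>circle_measure) = (\<Sum>k. ennreal ((norm (a k))\<^sup>2) * ennreal ((norm z)\<^sup>2 ^ k))"
    if z: "norm z < 1" for z
  proof -
    have s: "summable (\<lambda>k. norm (a k * z ^ k))"
      by (rule summable_comparison_test'[OF a, of 0])
         (use z in \<open>auto simp: norm_mult norm_power mult_left_le power_le_one\<close>)
    have "(\<integral>\<^sup>+w. ?H (w * z) \<partial>circle_measure)
        = (\<integral>\<^sup>+w. ennreal ((norm (\<Sum>k. (a k * z ^ k) * w ^ k))\<^sup>2) \<partial>circle_measure)"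
      by (simp add: power_mult_distrib mult_ac)
    also have "\<dots> = ennreal (\<Sum>k. (norm (a k * z ^ k))\<^sup>2)"
      using s by (rule circle_Parseval)
    also have "\<dots> = (\<Sum>k. ennreal ((norm (a k * z ^ k))\<^sup>2))"
      by (rule suminf_ennreal2[symmetric]) (auto intro: summable_norm_square s)
    finally show ?thesis
      by (simp add: norm_mult norm_power power_mult_distrib ennreal_mult flip: power_mult mult.commute[of 2])
  qed
  have "(\<integral>\<^sup>+z. ?H z \<partial>disc_measure m) = (\<integral>\<^sup>+w. (\<integral>\<^sup>+z. ?H z \<partial>disc_measure m) \<partial>circle_measure)"
    by (simp add: emeasure_circle_measure)
  also have "\<dots> = (\<integral>\<^sup>+w. (\<integral>\<^sup>+z. ?H (w * z) \<partial>disc_measure m) \<partial>circle_measure)"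
    by (rule nn_integral_cong_AE, use AE_circle_measure in eventually_elim)
       (subst nn_integral_disc_rotate, auto)
  also have "\<dots> = (\<integral>\<^sup>+z. (\<integral>\<^sup>+w. ?H (w * z) \<partial>circle_measure) \<partial>disc_measure m)"
    by (rule AB.Fubini') measurable
  also have "\<dots> = (\<integral>\<^sup>+z. (\<Sum>k. ennreal ((norm (a k))\<^sup>2) * ennreal ((norm z)\<^sup>2 ^ k)) \<partial>disc_measure m)"
    by (rule nn_integral_cong_AE, use AE_disc_measure in eventually_elim) (rule circle)
  also have "\<dots> = (\<Sum>k. ennreal ((norm (a k))\<^sup>2 / real ((k + (m - 1)) choose k)))"
  proof (subst nn_integral_suminf)
    show "(\<Sum>k. \<integral>\<^sup>+z. ennreal ((norm (a k))\<^sup>2) * ennreal ((norm z)\<^sup>2 ^ k) \<partial>disc_measure m)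
        = (\<Sum>k. ennreal ((norm (a k))\<^sup>2 / real ((k + (m - 1)) choose k)))"
    proof (rule arg_cong[where f = suminf], rule ext)
      fix k
      have "(\<integral>\<^sup>+z. ennreal ((norm (a k))\<^sup>2) * ennreal ((norm z)\<^sup>2 ^ k) \<partial>disc_measure m)
          = ennreal ((norm (a k))\<^sup>2) * ennreal (1 / real ((k + (m - 1)) choose k))"
        unfolding disc_moment[OF m, symmetric] by (rule nn_integral_cmult) measurable
      then show "(\<integral>\<^sup>+z. ennreal ((norm (a k))\<^sup>2) * ennreal ((norm z)\<^sup>2 ^ k) \<partial>disc_measure m)
          = ennreal ((norm (a k))\<^sup>2 / real ((k + (m - 1)) choose k))"
        by (simp flip: ennreal_mult')
    qed
  qed measurable
  finally show ?thesis .
qed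

text \<open>Exponent two: both sides are sums over Taylor coefficients, so this is the coefficient
  bound for products.\<close>
lemma Bergman_Hardy_inequality_power_series:
  fixes a :: "nat \<Rightarrow> nat \<Rightarrow> complex"
  assumes m: "m \<ge> 2" and a: "\<And>j. j < m \<Longrightarrow> summable (\<lambda>k. norm (a j k))"
  shows "(\<integral>\<^sup>+z. (\<Prod>j<m. ennreal ((norm (\<Sum>k. a j k * z ^ k))\<^sup>2)) \<partial>disc_measure m)
     \<le> (\<Prod>j<m. \<integral>\<^sup>+w. ennreal ((norm (\<Sum>k. a j k * w ^ k))\<^sup>2) \<partial>circle_measure)"
proof -
  have set_eq: "{..<m} = {..m - 1}" using m by auto
  obtain c where c: "summable (\<lambda>k. norm (c k))"
     "\<And>z. norm z \<le> 1 \<Longrightarrow> (\<Prod>j<m. \<Sum>k. a j k * z ^ k) = (\<Sum>k. c k * z ^ k)"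
     "summable (\<lambda>k. (norm (c k))\<^sup>2 / real ((k + (m - 1)) choose k))"
     "(\<Sum>k. (norm (c k))\<^sup>2 / real ((k + (m - 1)) choose k)) \<le> (\<Prod>j<m. \<Sum>k. (norm (a j k))\<^sup>2)"
    using product_power_series_bound[of "m - 1" a] a m unfolding set_eq by force
  have "(\<integral>\<^sup>+z. (\<Prod>j<m. ennreal ((norm (\<Sum>k. a j k * z ^ k))\<^sup>2)) \<partial>disc_measure m)
      = (\<integral>\<^sup>+z. ennreal ((norm (\<Sum>k. c k * z ^ k))\<^sup>2) \<partial>disc_measure m)"
  proof (rule nn_integral_cong_AE, use AE_disc_measure in eventually_elim)
    fix z :: complex assume "norm z < 1"
    then show "(\<Prod>j<m. ennreal ((norm (\<Sum>k. a j k * z ^ k))\<^sup>2)) = ennreal ((norm (\<Sum>k. c k * z ^ k))\<^sup>2)"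
      using c(2)[of z, symmetric] by (simp add: prod_ennreal prod_power_distrib flip: prod_norm)
  qed
  also have "\<dots> = (\<Sum>k. ennreal ((norm (c k))\<^sup>2 / real ((k + (m - 1)) choose k)))"
    by (rule disc_power_series) fact+
  also have "\<dots> = ennreal (\<Sum>k. (norm (c k))\<^sup>2 / real ((k + (m - 1)) choose k))"
    using c(3) by (intro suminf_ennreal2) auto
  also have "\<dots> \<le> ennreal (\<Prod>j<m. \<Sum>k. (norm (a j k))\<^sup>2)"
    by (rule ennreal_leI) fact
  also have "\<dots> = (\<Prod>j<m. ennreal (\<Sum>k. (norm (a j k))\<^sup>2))"
    by (rule prod_ennreal[symmetric]) (auto intro!: suminf_nonneg summable_norm_square a)
  also have "\<dots> = (\<Prod>j<m. \<integral>\<^sup>+w. ennreal ((norm (\<Sum>k. a j k * w ^ k))\<^sup>2) \<partial>circle_measure)"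
    by (intro prod.cong refl circle_Parseval[symmetric] a) auto
  finally show ?thesis .
qed

section \<open>Removing zeros\<close>

text \<open>The square of the right-hand side exceeds that of the left-hand side by
  \<open>(1 - |a|\<^sup>2) * (1 - |z|\<^sup>2)\<close>.\<close>
lemma norm_Blaschke_factor_le:
  fixes a z :: complex
  assumes "norm a \<le> 1" "norm z \<le> 1"
  shows "norm (z - a) \<le> norm (1 - cnj a * z)"
    and "norm z = 1 \<Longrightarrow> norm (z - a) = norm (1 - cnj a * z)"
proof -
  have "(norm (1 - cnj a * z))\<^sup>2 - (norm (z - a))\<^sup>2 = (1 - (norm a)\<^sup>2) * (1 - (norm z)\<^sup>2)"
    unfolding cmod_power2 by (simp add: power2_eq_square algebra_simps)
  moreover have "(norm a)\<^sup>2 \<le> 1" "(norm z)\<^sup>2 \<le> 1"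
    using assms by (simp_all add: power_le_one)
  ultimately have "(norm (z - a))\<^sup>2 \<le> (norm (1 - cnj a * z))\<^sup>2"
    and "norm z = 1 \<Longrightarrow> (norm (z - a))\<^sup>2 = (norm (1 - cnj a * z))\<^sup>2"
    by (smt (verit) mult_nonneg_nonneg, simp)
  then show "norm (z - a) \<le> norm (1 - cnj a * z)"
    and "norm z = 1 \<Longrightarrow> norm (z - a) = norm (1 - cnj a * z)"
    by (auto intro: power2_le_imp_le)
qed

lemma holomorphic_divide_zero:
  assumes h: "h holomorphic_on S" and S: "open S" "connected S" and a: "a \<in> S" "h a = 0"
    and nz: "\<exists>z\<in>S. h z \<noteq> 0"
  obtains n k where "k holomorphic_on S" "\<And>z. z \<in> S \<Longrightarrow> h z = (z - a) ^ n * k z" "k a \<noteq> 0"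
proof -
  have "\<not> h constant_on S"
    using a nz unfolding constant_on_def by metis
  then obtain g r n where n: "0 < n" and r: "0 < r" "ball a r \<subseteq> S" and g: "g holomorphic_on ball a r"
      "\<And>z. z \<in> ball a r \<Longrightarrow> h z = (z - a) ^ n * g z" "\<And>z. z \<in> ball a r \<Longrightarrow> g z \<noteq> 0"
    using holomorphic_factor_zero_nonconstant[OF h S a] by metis
  define k where "k z = (if z = a then g a else h z / (z - a) ^ n)" for z
  have k_eq: "k z = g z" if "z \<in> ball a r" for z
    using g(2)[OF that] by (simp add: k_def)
  have "k holomorphic_on ball a r"
    by (rule holomorphic_transform[OF g(1)]) (simp add: k_eq)
  moreover have "k holomorphic_on S - {a}"
  proof (rule holomorphic_transform[of "\<lambda>z. h z / (z - a) ^ n"])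
    show "(\<lambda>z. h z / (z - a) ^ n) holomorphic_on S - {a}"
      by (intro holomorphic_intros holomorphic_on_subset[OF h]) auto
  qed (simp add: k_def)
  ultimately have "k holomorphic_on ball a r \<union> (S - {a})"
    using S by (intro holomorphic_on_Un) auto
  moreover have "ball a r \<union> (S - {a}) = S" using r a by auto
  ultimately have "k holomorphic_on S" by simp
  moreover have "h z = (z - a) ^ n * k z" if "z \<in> S" for z
    using n a by (simp add: k_def)
  moreover have "k a \<noteq> 0" using r g(3)[of a] by (simp add: k_def)
  ultimately show ?thesis by (rule that)
qed

text \<open>Dividing by the Blaschke product of the zeros, written without quotients: each factor
  \<open>z - a\<close> is replaced by \<open>1 - cnj a * z\<close>, which has no zero in the disc, the same modulus on
  the circle and a larger one inside. The induction is on the number of distinct zeros in the open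
  disc. Zeros on the circle may stay.\<close>
lemma zero_free_majorant:
  assumes h: "h holomorphic_on ball 0 R" and R: "R > 1" and nz: "\<exists>z\<in>ball 0 1. h z \<noteq> 0"
  shows "\<exists>g. g holomorphic_on ball 0 R \<and> (\<forall>z\<in>ball 0 1. g z \<noteq> 0 \<and> norm (h z) \<le> norm (g z)) \<and>
           (\<forall>z. norm z = 1 \<longrightarrow> norm (g z) = norm (h z))"
proof -
  define Z where "Z h = {z \<in> ball 0 1. h z = (0::complex)}" for h :: "complex \<Rightarrow> complex"
  have fin: "finite (Z h)" if "h holomorphic_on ball 0 R" "\<exists>z\<in>ball 0 1. h z \<noteq> 0" for h
  proof (cases "h constant_on ball 0 R")
    case True
    moreover have "ball (0::complex) 1 \<subseteq> ball 0 R" using R by auto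
    ultimately obtain c where "\<And>z. z \<in> ball 0 1 \<Longrightarrow> h z = c"
      unfolding constant_on_def by blast
    then have "Z h = {}" using that(2) by (auto simp: Z_def)
    then show ?thesis by simp
  next
    case False
    then have "finite {z \<in> cball 0 1. h z = 0}"
      by (intro holomorphic_compact_finite_zeros[OF that(1)]) (use R in auto)
    then show ?thesis by (rule rev_finite_subset) (auto simp: Z_def)
  qed
  show ?thesis
    using h nz
  proof (induction "card (Z h)" arbitrary: h)
    case 0
    then have "Z h = {}" using fin[of h] by simp
    then show ?case using 0 by (intro exI[of _ h]) (auto simp: Z_def)
  next
    case (Suc N)
    then obtain a where a: "a \<in> Z h" by (metis card.empty ex_in_conv nat.distinct(1))
    then have a1: "norm a < 1" "h a = 0" by (auto simp: Z_def)
    have nzR: "\<exists>z\<in>ball 0 R. h z \<noteq> 0" using Suc.prems(2) R by force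
    obtain n k where k: "k holomorphic_on ball 0 R" "\<And>z. z \<in> ball 0 R \<Longrightarrow> h z = (z - a) ^ n * k z" "k a \<noteq> 0"
      by (rule holomorphic_divide_zero[OF Suc.prems(1) open_ball connected_ball _ a1(2) nzR])
         (use a1(1) R in auto)
    \<comment> \<open>The reflected factor takes the zero \<open>a\<close> away without lowering the modulus on the disc.\<close>
    define k' where "k' z = (1 - cnj a * z) ^ n * k z" for z
    have ne: "1 - cnj a * z \<noteq> 0" if "norm z < 1" for z
    proof
      assume "1 - cnj a * z = 0"
      then have "norm (cnj a * z) = 1" by simp
      moreover have "norm a * norm z < 1 * 1"
        by (rule mult_strict_mono') (use a1(1) that in auto)
      ultimately show False by (simp add: norm_mult)
    qed
    have k'_hol: "k' holomorphic_on ball 0 R"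
      unfolding k'_def by (intro holomorphic_intros k(1))
    have "Z k' = Z h - {a}"
      using k ne R by (force simp: Z_def k'_def)
    then have "N = card (Z k')" using Suc.hyps(2) a fin[of h] Suc.prems by simp
    moreover have "\<exists>z\<in>ball 0 1. k' z \<noteq> 0"
      using a1 k(3) ne by (intro bexI[of _ a]) (auto simp: k'_def)
    ultimately obtain g where g: "g holomorphic_on ball 0 R"
        "\<forall>z\<in>ball 0 1. g z \<noteq> 0 \<and> norm (k' z) \<le> norm (g z)" "\<forall>z. norm z = 1 \<longrightarrow> norm (g z) = norm (k' z)"
      using Suc.hyps(1)[OF _ k'_hol] by blast
    have h_le: "norm (h z) \<le> norm (k' z)" if "norm z \<le> 1" for z
      using norm_Blaschke_factor_le(1)[of a z] a1 that R k(2)[of z]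
      by (auto simp: k'_def norm_mult norm_power intro!: mult_right_mono power_mono)
    have h_eq: "norm (h z) = norm (k' z)" if "norm z = 1" for z
      using norm_Blaschke_factor_le(2)[of a z] a1 that R k(2)[of z]
      by (simp add: k'_def norm_mult norm_power)
    show ?case
    proof (intro exI[of _ g] conjI ballI allI impI g(1))
      fix z :: complex assume z: "z \<in> ball 0 1"
      then show "g z \<noteq> 0" using g(2) by blast
      have "norm (h z) \<le> norm (k' z)" using z by (intro h_le) simp
      also have "\<dots> \<le> norm (g z)" using g(2) z by blast
      finally show "norm (h z) \<le> norm (g z)" .
    next
      fix z :: complex assume "norm z = 1"
      then show "norm (g z) = norm (h z)" using g(3) h_eq by simp
    qed
  qed
qed

section \<open>The inequality in one variable\<close>

lemma holomorphic_power_series_summable: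
  assumes G: "G holomorphic_on ball 0 R" and R: "R > 1"
  obtains a :: "nat \<Rightarrow> complex" where "summable (\<lambda>k. norm (a k))"
    "\<And>z. norm z \<le> 1 \<Longrightarrow> G z = (\<Sum>k. a k * z ^ k)"
proof
  let ?a = "\<lambda>k. (deriv ^^ k) G 0 / fact k"
  have s: "(\<lambda>k. ?a k * z ^ k) sums G z" if "norm z < R" for z
    using holomorphic_power_series[OF G, of z] that by simp
  obtain r where r: "1 < r" "r < R" using R dense by blast
  have "summable (\<lambda>k. norm (?a k * 1 ^ k))"
    by (rule powser_insidea[of _ "of_real r"]) (use s[of "of_real r"] r in \<open>auto simp: sums_iff\<close>)
  then show "summable (\<lambda>k. norm (?a k))" by simp
  show "G z = (\<Sum>k. ?a k * z ^ k)" if "norm z \<le> 1" for z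
    using s[of z] that R by (simp add: sums_iff)
qed

text \<open>A zero-free function on the disc has a holomorphic power with exponent \<open>p / 2\<close>, and the case of
  exponent two applies to it. The dilation by \<open>s\<close> makes the Taylor series of that power absolutely
  convergent on the closed disc.\<close>
lemma Bergman_Hardy_inequality_zero_free:
  fixes g :: "nat \<Rightarrow> complex \<Rightarrow> complex"
  assumes m: "m \<ge> 2" and s: "0 < s" "s < 1"
    and g: "\<And>j. j < m \<Longrightarrow> g j holomorphic_on ball 0 1" "\<And>j z. j < m \<Longrightarrow> norm z < 1 \<Longrightarrow> g j z \<noteq> 0"
  shows "(\<integral>\<^sup>+z. (\<Prod>j<m. ennreal (norm (g j (of_real s * z)) powr p)) \<partial>disc_measure m)
     \<le> (\<Prod>j<m. \<integral>\<^sup>+w. ennreal (norm (g j (of_real s * w)) powr p) \<partial>circle_measure)"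
proof -
  have "\<exists>a. summable (\<lambda>k. norm (a k)) \<and>
      (\<forall>z. norm z \<le> 1 \<longrightarrow> norm (g j (of_real s * z)) powr p = (norm (\<Sum>k. a k * z ^ k))\<^sup>2)"
    if j: "j < m" for j
  proof -
    obtain L where L: "L holomorphic_on ball 0 1" "\<And>z. z \<in> ball 0 1 \<Longrightarrow> exp (L z) = g j z"
      using holomorphic_logarithm_exists[of "ball 0 1" "g j" 0] g j by auto
    have sz: "norm (of_real s * z) < 1" if "norm z < 1 / s" for z :: complex
      using that s by (simp add: norm_mult field_simps)
    have "(\<lambda>z. L (of_real s * z)) holomorphic_on ball 0 (1 / s)"
      by (rule holomorphic_on_compose_gen[OF _ L(1), unfolded o_def])
         (use sz in \<open>auto intro!: holomorphic_intros\<close>)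
    then have "(\<lambda>z. exp (of_real (p / 2) * L (of_real s * z))) holomorphic_on ball 0 (1 / s)"
      by (intro holomorphic_intros)
    moreover have "1 / s > 1" using s by simp
    ultimately obtain a where a: "summable (\<lambda>k. norm (a k))"
      "\<And>z. norm z \<le> 1 \<Longrightarrow> exp (of_real (p / 2) * L (of_real s * z)) = (\<Sum>k. a k * z ^ k)"
      by (rule holomorphic_power_series_summable) blast
    have "norm (g j (of_real s * z)) powr p = (norm (\<Sum>k. a k * z ^ k))\<^sup>2" if z: "norm z \<le> 1" for z
    proof -
      have "norm z < 1 / s" using z \<open>1 / s > 1\<close> by linarith
      then have "of_real s * z \<in> ball 0 1" using sz by auto
      from L(2)[OF this] have "norm (g j (of_real s * z)) = exp (Re (L (of_real s * z)))"
        by (metis norm_exp_eq_Re)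
      then have "norm (g j (of_real s * z)) powr p = exp (p * Re (L (of_real s * z)))"
        by (simp add: powr_def)
      also have "\<dots> = (norm (exp (of_real (p / 2) * L (of_real s * z))))\<^sup>2"
        by (simp add: norm_exp_eq_Re flip: exp_double)
      finally show ?thesis unfolding a(2)[OF z] .
    qed
    with a(1) show ?thesis by blast
  qed
  then obtain a where a: "\<And>j. j < m \<Longrightarrow> summable (\<lambda>k. norm (a j k))"
    "\<And>j z. j < m \<Longrightarrow> norm z \<le> 1 \<Longrightarrow> norm (g j (of_real s * z)) powr p = (norm (\<Sum>k. a j k * z ^ k))\<^sup>2"
    by metis
  have "(\<integral>\<^sup>+z. (\<Prod>j<m. ennreal (norm (g j (of_real s * z)) powr p)) \<partial>disc_measure m)
      = (\<integral>\<^sup>+z. (\<Prod>j<m. ennreal ((norm (\<Sum>k. a j k * z ^ k))\<^sup>2)) \<partial>disc_measure m)"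
    by (rule nn_integral_cong_AE, use AE_disc_measure in eventually_elim) (simp add: a(2))
  also have "\<dots> \<le> (\<Prod>j<m. \<integral>\<^sup>+w. ennreal ((norm (\<Sum>k. a j k * w ^ k))\<^sup>2) \<partial>circle_measure)"
    by (rule Bergman_Hardy_inequality_power_series) (use m a in auto)
  also have "\<dots> = (\<Prod>j<m. \<integral>\<^sup>+w. ennreal (norm (g j (of_real s * w)) powr p) \<partial>circle_measure)"
    by (intro prod.cong refl nn_integral_cong_AE, use AE_circle_measure in eventually_elim)
       (simp add: a(2))
  finally show ?thesis .
qed

text \<open>Precomposing with this retraction turns a function that is continuous on the closed disc only
  into a globally continuous, hence Borel measurable, one.\<close>
definition disc_retraction :: "complex \<Rightarrow> complex" where
  "disc_retraction z = z /\<^sub>R max 1 (norm z)"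

lemma disc_retraction_id: "norm z \<le> 1 \<Longrightarrow> disc_retraction z = z"
  by (simp add: disc_retraction_def max_absorb1)

lemma norm_disc_retraction: "norm (disc_retraction z) \<le> 1"
proof -
  have "0 < max 1 (norm z)" by (simp add: less_max_iff_disj)
  then show ?thesis
    by (simp add: disc_retraction_def field_simps)
qed

lemma continuous_disc_retraction: "continuous_on S disc_retraction"
  unfolding disc_retraction_def by (intro continuous_intros) auto

text \<open>The integrands of the one-variable inequality. Only values on the closed disc are prescribed,
  since both measures live there; this leaves room for globally measurable representatives.\<close>
definition hardy_type :: "real \<Rightarrow> (complex \<Rightarrow> ennreal) set" where
  "hardy_type p = {F. \<exists>h R. R > 1 \<and> h holomorphic_on ball 0 R \<and>
      (\<forall>z. norm z \<le> 1 \<longrightarrow> F z = ennreal (norm (h z) powr p))}"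

text \<open>Passing to zero-free majorants keeps the right-hand side and can only increase the left-hand
  side. The zero-free case is available for the dilations by \<open>s n < 1\<close>; as \<open>s n\<close> tends to one,
  the circle averages converge by dominated convergence, and Fatou's lemma handles the disc.\<close>
lemma Bergman_Hardy_inequality_one_variable:
  fixes F :: "nat \<Rightarrow> complex \<Rightarrow> ennreal"
  assumes m: "m \<ge> 2" and p: "p > 0" and F: "\<And>j. j < m \<Longrightarrow> F j \<in> hardy_type p"
  shows "(\<integral>\<^sup>+z. (\<Prod>j<m. F j z) \<partial>disc_measure m) \<le> (\<Prod>j<m. \<integral>\<^sup>+w. F j w \<partial>circle_measure)"
proof -
  interpret B: finite_measure circle_measure by (rule finite_circle_measure)
  obtain h R where R: "\<And>j. j < m \<Longrightarrow> R j > 1" and h: "\<And>j. j < m \<Longrightarrow> h j holomorphic_on ball 0 (R j)"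
    and Fh: "\<And>j z. j < m \<Longrightarrow> norm z \<le> 1 \<Longrightarrow> F j z = ennreal (norm (h j z) powr p)"
    using F unfolding hardy_type_def by simp metis
  show ?thesis
  proof (cases "\<exists>j<m. \<forall>z\<in>ball 0 1. h j z = 0")
    \<comment> \<open>A factor that vanishes identically has no zero-free majorant.\<close>
    case True
    then obtain j where j: "j < m" "\<And>z. norm z < 1 \<Longrightarrow> h j z = 0" by auto
    have "(\<integral>\<^sup>+z. (\<Prod>j<m. F j z) \<partial>disc_measure m) = (\<integral>\<^sup>+z. 0 \<partial>disc_measure m)"
    proof (rule nn_integral_cong_AE, use AE_disc_measure in eventually_elim)
      fix z :: complex assume "norm z < 1"
      then have "F j z = 0" using Fh[OF j(1)] j(2) by simp
      then show "(\<Prod>j<m. F j z) = 0" using j(1) by (auto intro!: prod_zero)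
    qed
    then show ?thesis by simp
  next
    case False
    then have "\<forall>j. j < m \<longrightarrow> (\<exists>g. g holomorphic_on ball 0 (R j) \<and>
        (\<forall>z\<in>ball 0 1. g z \<noteq> 0 \<and> norm (h j z) \<le> norm (g z)) \<and>
        (\<forall>z. norm z = 1 \<longrightarrow> norm (g z) = norm (h j z)))"
      using zero_free_majorant[OF h R] by blast
    then obtain g where "\<forall>j. j < m \<longrightarrow> g j holomorphic_on ball 0 (R j) \<and>
        (\<forall>z\<in>ball 0 1. g j z \<noteq> 0 \<and> norm (h j z) \<le> norm (g j z)) \<and>
        (\<forall>z. norm z = 1 \<longrightarrow> norm (g j z) = norm (h j z))"
      unfolding choice_iff' by blast
    then have g: "\<And>j. j < m \<Longrightarrow> g j holomorphic_on ball 0 (R j)"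
       "\<And>j z. j < m \<Longrightarrow> norm z < 1 \<Longrightarrow> g j z \<noteq> 0"
       "\<And>j z. j < m \<Longrightarrow> norm z < 1 \<Longrightarrow> norm (h j z) \<le> norm (g j z)"
       "\<And>j z. j < m \<Longrightarrow> norm z = 1 \<Longrightarrow> norm (g j z) = norm (h j z)"
      by auto
    define u where "u s j z = norm (g j (of_real s * disc_retraction z)) powr p" for s :: real and j z
    define s where "s n = 1 - 1 / (real n + 2)" for n
    have s: "0 < s n" "s n < 1" for n by (auto simp: s_def)
    have s_lim: "s \<longlonglongrightarrow> 1" unfolding s_def
      using LIMSEQ_Suc[OF LIMSEQ_inverse_real_of_nat_add_minus[of 1]] by (simp add: field_simps)
    have cont: "continuous_on (cball 0 1) (g j)" if "j < m" for j
      by (rule continuous_on_subset[OF holomorphic_on_imp_continuous_on[OF g(1)[OF that]]])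
         (use R[OF that] in auto)
    have norm_le: "norm (of_real t * disc_retraction z) \<le> 1" if "0 \<le> t" "t \<le> 1" for t z
      using that norm_disc_retraction[of z] by (simp add: norm_mult mult_le_one)
    have u_meas: "u t j \<in> borel_measurable borel" if "j < m" "0 \<le> t" "t \<le> 1" for t j
    proof -
      have "continuous_on UNIV (\<lambda>z. g j (of_real t * disc_retraction z))"
        by (rule continuous_on_compose2[OF cont[OF that(1)]])
           (use norm_le[OF that(2,3)] in \<open>auto intro!: continuous_intros continuous_disc_retraction\<close>)
      then have [measurable]: "(\<lambda>z. g j (of_real t * disc_retraction z)) \<in> borel_measurable borel"
        by (rule borel_measurable_continuous_onI)
      show ?thesis unfolding u_def[abs_def] by measurable
    qed
    have u_lim: "(\<lambda>n. u (s n) j z) \<longlonglongrightarrow> u 1 j z" if "j < m" for j z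
    proof -
      have "(\<lambda>n. g j (of_real (s n) * disc_retraction z)) \<longlonglongrightarrow> g j (of_real 1 * disc_retraction z)"
        by (rule continuous_on_tendsto_compose[OF cont[OF that]])
           (use norm_le s in \<open>auto intro!: tendsto_intros s_lim simp: less_imp_le norm_disc_retraction simp del: of_real_1\<close>)
      then show ?thesis unfolding u_def using p by (intro tendsto_powr' tendsto_norm tendsto_const) auto
    qed
    have "\<exists>M. \<forall>t z. 0 \<le> t \<longrightarrow> t \<le> 1 \<longrightarrow> u t j z \<le> M" if "j < m" for j
    proof -
      have "bounded (g j ` cball 0 1)"
        by (intro compact_imp_bounded compact_continuous_image cont that) auto
      then obtain C where "\<forall>x\<in>g j ` cball 0 1. norm x \<le> C"
        unfolding bounded_iff by blast
      then have C: "norm (g j z) \<le> C" if "norm z \<le> 1" for z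
        using that by simp
      have "u t j z \<le> C powr p" if "0 \<le> t" "t \<le> 1" for t z
        unfolding u_def using p by (intro powr_mono2 C norm_le that) auto
      then show ?thesis by blast
    qed
    then obtain M where M: "\<And>j t z. j < m \<Longrightarrow> 0 \<le> t \<Longrightarrow> t \<le> 1 \<Longrightarrow> u t j z \<le> M j"
      by metis
    have u_nonneg: "u t j z \<ge> 0" for t j z by (simp add: u_def)
    define I where "I t j = (\<integral>w. u t j w \<partial>circle_measure)" for t j
    have I: "(\<integral>\<^sup>+w. ennreal (u t j w) \<partial>circle_measure) = ennreal (I t j)" if "j < m" "0 \<le> t" "t \<le> 1" for t j
      unfolding I_def
    proof (rule nn_integral_eq_integral)
      show "integrable circle_measure (u t j)"
        by (rule B.integrable_const_bound[where B = "M j"])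
           (use u_nonneg M that u_meas in \<open>auto simp: measurable_cong_sets[OF sets_circle_measure refl]\<close>)
    qed (simp add: u_nonneg)
    have I_lim: "(\<lambda>n. I (s n) j) \<longlonglongrightarrow> I 1 j" if "j < m" for j
      unfolding I_def
    proof (rule integral_dominated_convergence[where w = "\<lambda>_. M j"])
      show "AE z in circle_measure. norm (u (s n) j z) \<le> M j" for n
        using M[OF that] s[of n] u_nonneg by (auto simp: less_imp_le)
    qed (use u_meas[OF that] s u_lim[OF that] in \<open>auto simp: less_imp_le measurable_cong_sets[OF sets_circle_measure refl]\<close>)
    have "(\<integral>\<^sup>+z. (\<Prod>j<m. F j z) \<partial>disc_measure m) \<le> (\<integral>\<^sup>+z. ennreal (\<Prod>j<m. u 1 j z) \<partial>disc_measure m)"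
    proof (rule nn_integral_mono_AE, use AE_disc_measure in eventually_elim)
      fix z :: complex assume z: "norm z < 1"
      have "F j z \<le> ennreal (u 1 j z)" if "j < m" for j
        using z that g(3)[OF that z] p Fh[OF that, of z]
        by (auto simp: u_def disc_retraction_id intro!: ennreal_leI powr_mono2)
      then show "(\<Prod>j<m. F j z) \<le> ennreal (\<Prod>j<m. u 1 j z)"
        by (subst prod_ennreal[symmetric]) (auto intro!: prod_mono_ennreal u_nonneg)
    qed
    also have "\<dots> = (\<integral>\<^sup>+z. liminf (\<lambda>n. ennreal (\<Prod>j<m. u (s n) j z)) \<partial>disc_measure m)"
      by (intro nn_integral_cong lim_imp_Liminf[symmetric] tendsto_ennrealI tendsto_prod u_lim) auto
    also have "\<dots> \<le> liminf (\<lambda>n. \<integral>\<^sup>+z. ennreal (\<Prod>j<m. u (s n) j z) \<partial>disc_measure m)"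
      using u_meas s
      by (intro nn_integral_liminf measurable_compose[OF _ measurable_ennreal] borel_measurable_prod)
         (auto simp: less_imp_le measurable_cong_sets[OF sets_disc_measure refl])
    also have "\<dots> \<le> liminf (\<lambda>n. ennreal (\<Prod>j<m. I (s n) j))"
    proof (intro Liminf_mono always_eventually allI)
      fix n
      have "(\<integral>\<^sup>+z. ennreal (\<Prod>j<m. u (s n) j z) \<partial>disc_measure m)
          = (\<integral>\<^sup>+z. (\<Prod>j<m. ennreal (norm (g j (of_real (s n) * z)) powr p)) \<partial>disc_measure m)"
        by (rule nn_integral_cong_AE, use AE_disc_measure in eventually_elim)
           (simp add: u_def disc_retraction_id prod_ennreal)
      also have "\<dots> \<le> (\<Prod>j<m. \<integral>\<^sup>+w. ennreal (norm (g j (of_real (s n) * w)) powr p) \<partial>circle_measure)"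
      proof (rule Bergman_Hardy_inequality_zero_free[OF m s])
        show "g j holomorphic_on ball 0 1" if "j < m" for j
          by (rule holomorphic_on_subset[OF g(1)[OF that]]) (use R[OF that] in auto)
      qed (use g in auto)
      also have "\<dots> = (\<Prod>j<m. \<integral>\<^sup>+w. ennreal (u (s n) j w) \<partial>circle_measure)"
        by (intro prod.cong refl nn_integral_cong_AE, use AE_circle_measure in eventually_elim)
           (simp add: u_def disc_retraction_id)
      also have "\<dots> = ennreal (\<Prod>j<m. I (s n) j)"
        using s[of n] by (subst prod_ennreal[symmetric]) (auto simp: I less_imp_le I_def u_nonneg)
      finally show "(\<integral>\<^sup>+z. ennreal (\<Prod>j<m. u (s n) j z) \<partial>disc_measure m) \<le> ennreal (\<Prod>j<m. I (s n) j)" .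
    qed
    also have "\<dots> = ennreal (\<Prod>j<m. I 1 j)"
      by (intro lim_imp_Liminf tendsto_ennrealI tendsto_prod I_lim) auto
    also have "\<dots> = (\<Prod>j<m. \<integral>\<^sup>+w. ennreal (u 1 j w) \<partial>circle_measure)"
      by (subst prod_ennreal[symmetric]) (auto simp: I I_def u_nonneg)
    also have "\<dots> = (\<Prod>j<m. \<integral>\<^sup>+w. F j w \<partial>circle_measure)"
      by (intro prod.cong refl nn_integral_cong_AE, use AE_circle_measure in eventually_elim)
         (simp add: u_def disc_retraction_id g(4) Fh)
    finally show ?thesis .
  qed
qed

section \<open>Tensor products of inequalities\<close>

text \<open>An inequality between the integral of a product over \<open>A\<close> and the product of the integrals
  over \<open>B\<close> passes to powers of the measures. In the induction step, the inequality in the new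
  coordinate \<open>i\<close> gives a product of integrals over \<open>B\<close>. Written as one integral with an
  independent variable \<open>\<omega> j\<close> for each factor \<open>j\<close>, it can be exchanged with the integration over
  the old coordinates, so that the induction hypothesis is applied for fixed \<open>\<omega>\<close>. The functions to
  which it is applied are then slices of the given ones, and their slices lie in \<open>C\<close> again. With
  moduli of holomorphic functions in mind, this order matters: integrals of such moduli over some of
  the coordinates are in general not moduli of holomorphic functions.\<close>
lemma product_inequality_tensorizes:
  fixes A B :: "'b::topological_space measure" and C :: "('b \<Rightarrow> ennreal) set"
    and F :: "'j \<Rightarrow> ('i \<Rightarrow> 'b) \<Rightarrow> ennreal"
  assumes A: "sigma_finite_measure A" and A_borel[measurable_cong]: "sets A = sets borel"
    and B: "sigma_finite_measure B" and B_borel[measurable_cong]: "sets B = sets borel"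
    and J: "finite J"
    and one: "\<And>F. (\<And>j. j \<in> J \<Longrightarrow> F j \<in> C) \<Longrightarrow>
      (\<integral>\<^sup>+y. (\<Prod>j\<in>J. F j y) \<partial>A) \<le> (\<Prod>j\<in>J. \<integral>\<^sup>+y. F j y \<partial>B)"
    and I: "finite I"
    and meas: "\<And>j. j \<in> J \<Longrightarrow> F j \<in> borel_measurable (Pi\<^sub>M I (\<lambda>_. borel))"
    and slice: "\<And>j i x. j \<in> J \<Longrightarrow> i \<in> I \<Longrightarrow> (\<lambda>y. F j (x(i := y))) \<in> C"
  shows "(\<integral>\<^sup>+x. (\<Prod>j\<in>J. F j x) \<partial>Pi\<^sub>M I (\<lambda>_. A)) \<le> (\<Prod>j\<in>J. \<integral>\<^sup>+x. F j x \<partial>Pi\<^sub>M I (\<lambda>_. B))"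
  using I meas slice
proof (induction I arbitrary: F)
  case empty
  then show ?case by (simp add: PiM_empty nn_integral_count_space_finite)
next
  case (insert i I)
  interpret PA: product_sigma_finite "\<lambda>_::'i. A" by (rule product_sigma_finite.intro) (rule A)
  interpret PB: product_sigma_finite "\<lambda>_::'i. B" by (rule product_sigma_finite.intro) (rule B)
  interpret PJ: product_sigma_finite "\<lambda>_::'j. B" by (rule product_sigma_finite.intro) (rule B)
  interpret AJ: pair_sigma_finite "Pi\<^sub>M I (\<lambda>_. A)" "Pi\<^sub>M J (\<lambda>_. B)"
    using PA.sigma_finite[OF insert.hyps(1)] PJ.sigma_finite[OF J] by (simp add: pair_sigma_finite_def)
  note meas[measurable] = insert.prems(1)
  have [measurable]: "(\<lambda>x. F j x) \<in> borel_measurable (Pi\<^sub>M (insert i I) (\<lambda>_. A))"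
    "(\<lambda>x. F j x) \<in> borel_measurable (Pi\<^sub>M (insert i I) (\<lambda>_. B))" if "j \<in> J" for j
    using meas[OF that] by measurable
  have pair: "(\<lambda>(x, y). F j (x(i := y))) \<in> borel_measurable (Pi\<^sub>M I (\<lambda>_. borel) \<Otimes>\<^sub>M borel)" if "j \<in> J" for j
    using measurable_comp[OF measurable_add_dim meas[OF that]] by (simp add: comp_def case_prod_unfold)
  have [measurable]: "(\<lambda>(x, \<omega>). F j (x(i := \<omega> j))) \<in> borel_measurable (Pi\<^sub>M I (\<lambda>_. borel) \<Otimes>\<^sub>M Pi\<^sub>M J (\<lambda>_. borel))"
    if "j \<in> J" for j
  proof -
    have "(\<lambda>(x, \<omega>). (x, \<omega> j)) \<in> Pi\<^sub>M I (\<lambda>_. borel :: 'b measure) \<Otimes>\<^sub>M Pi\<^sub>M J (\<lambda>_. borel) \<rightarrow>\<^sub>M Pi\<^sub>M I (\<lambda>_. borel) \<Otimes>\<^sub>M borel"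
      using that by measurable
    from measurable_comp[OF this pair[OF that]] show ?thesis
      by (simp add: comp_def case_prod_unfold)
  qed
  have slice_x: "(\<lambda>x. F j (x(i := y))) \<in> borel_measurable (Pi\<^sub>M I (\<lambda>_. borel))" if "j \<in> J" for j y
    using measurable_Pair1[OF pair[OF that], of y] by simp
  have "(\<integral>\<^sup>+x. (\<Prod>j\<in>J. F j x) \<partial>Pi\<^sub>M (insert i I) (\<lambda>_. A))
      = (\<integral>\<^sup>+x. (\<integral>\<^sup>+y. (\<Prod>j\<in>J. F j (x(i := y))) \<partial>A) \<partial>Pi\<^sub>M I (\<lambda>_. A))"
    by (rule PA.product_nn_integral_insert) (use insert.hyps in auto)
  also have "\<dots> \<le> (\<integral>\<^sup>+x. (\<Prod>j\<in>J. \<integral>\<^sup>+y. F j (x(i := y)) \<partial>B) \<partial>Pi\<^sub>M I (\<lambda>_. A))"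
    by (intro nn_integral_mono one insert.prems) auto
  also have "\<dots> = (\<integral>\<^sup>+x. (\<integral>\<^sup>+\<omega>. (\<Prod>j\<in>J. F j (x(i := \<omega> j))) \<partial>Pi\<^sub>M J (\<lambda>_. B)) \<partial>Pi\<^sub>M I (\<lambda>_. A))"
  proof (rule nn_integral_cong)
    fix x assume "x \<in> space (Pi\<^sub>M I (\<lambda>_. A))"
    then have "x \<in> space (Pi\<^sub>M I (\<lambda>_. borel))" by (simp add: space_PiM sets_eq_imp_space_eq[OF A_borel])
    then have "(\<lambda>y. F j (x(i := y))) \<in> borel_measurable B" if "j \<in> J" for j
      using measurable_Pair2[OF pair[OF that]] by (simp add: measurable_cong_sets[OF B_borel refl])
    then show "(\<Prod>j\<in>J. \<integral>\<^sup>+y. F j (x(i := y)) \<partial>B)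
        = (\<integral>\<^sup>+\<omega>. (\<Prod>j\<in>J. F j (x(i := \<omega> j))) \<partial>Pi\<^sub>M J (\<lambda>_. B))"
      using PJ.product_nn_integral_prod[OF J, of "\<lambda>j y. F j (x(i := y))"] by simp
  qed
  also have "\<dots> = (\<integral>\<^sup>+\<omega>. (\<integral>\<^sup>+x. (\<Prod>j\<in>J. F j (x(i := \<omega> j))) \<partial>Pi\<^sub>M I (\<lambda>_. A)) \<partial>Pi\<^sub>M J (\<lambda>_. B))"
    by (rule AJ.Fubini'[symmetric]) measurable
  also have "\<dots> \<le> (\<integral>\<^sup>+\<omega>. (\<Prod>j\<in>J. \<integral>\<^sup>+x. F j (x(i := \<omega> j)) \<partial>Pi\<^sub>M I (\<lambda>_. B)) \<partial>Pi\<^sub>M J (\<lambda>_. B))"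
  proof (rule nn_integral_mono, rule insert.IH)
    fix \<omega> :: "'j \<Rightarrow> 'b" and j i' and x :: "'i \<Rightarrow> 'b" assume "j \<in> J" "i' \<in> I"
    have eq: "(x(i' := y))(i := \<omega> j) = (x(i := \<omega> j))(i' := y)" for y
      using \<open>i' \<in> I\<close> insert.hyps(2) by (intro fun_upd_twist) auto
    show "(\<lambda>y. F j ((x(i' := y))(i := \<omega> j))) \<in> C"
      unfolding eq using \<open>j \<in> J\<close> \<open>i' \<in> I\<close> by (intro insert.prems(2)) auto
  qed (rule slice_x)
  also have "\<dots> = (\<Prod>j\<in>J. \<integral>\<^sup>+y. (\<integral>\<^sup>+x. F j (x(i := y)) \<partial>Pi\<^sub>M I (\<lambda>_. B)) \<partial>B)"
  proof (rule PJ.product_nn_integral_prod[OF J])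
    fix j assume j: "j \<in> J"
    interpret S: sigma_finite_measure "Pi\<^sub>M I (\<lambda>_. B)" using PB.sigma_finite[OF insert.hyps(1)] .
    have "(\<lambda>(y, x). F j (x(i := y))) \<in> borel_measurable (B \<Otimes>\<^sub>M Pi\<^sub>M I (\<lambda>_. B))"
      using measurable_pair_swap[OF pair[OF j]] by (simp add: case_prod_unfold)
    then show "(\<lambda>y. \<integral>\<^sup>+x. F j (x(i := y)) \<partial>Pi\<^sub>M I (\<lambda>_. B)) \<in> borel_measurable B"
      by (rule S.borel_measurable_nn_integral)
  qed
  also have "\<dots> = (\<Prod>j\<in>J. \<integral>\<^sup>+x. F j x \<partial>Pi\<^sub>M (insert i I) (\<lambda>_. B))"
    by (intro prod.cong refl PB.product_nn_integral_insert_rev[symmetric]) (use insert.hyps in auto)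
  finally show ?case .
qed

section \<open>Products of weighted Lebesgue measures\<close>

lemma measurable_vec_lambda[measurable]:
  "(\<lambda>x. \<chi> k. x k) \<in> Pi\<^sub>M UNIV (\<lambda>_::'n::finite. borel :: 'a::euclidean_space measure) \<rightarrow>\<^sub>M borel"
proof (subst borel_measurable_euclidean_space, intro ballI)
  fix b :: "'a ^ 'n" assume "b \<in> Basis"
  then obtain k u where "b = axis k u" by (auto simp: Basis_vec_def)
  then show "(\<lambda>x. (\<chi> k. x k) \<bullet> b) \<in> borel_measurable (Pi\<^sub>M UNIV (\<lambda>_::'n. borel :: 'a measure))"
    by (simp add: inner_axis)
qed

lemma measurable_vec_nth[measurable]: "(\<lambda>z. z $ k) \<in> borel_measurable borel"
  by (intro borel_measurable_continuous_onI continuous_intros)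

lemma prod_over_Basis_vec:
  fixes f :: "'a::euclidean_space ^ 'n \<Rightarrow> real"
  shows "(\<Prod>b\<in>Basis. f b) = (\<Prod>k\<in>UNIV. \<Prod>u\<in>Basis. f (axis k u))"
proof -
  have inj: "inj_on (\<lambda>(k, u). axis k u :: 'a ^ 'n) (UNIV \<times> Basis)"
    by (auto simp: inj_on_def axis_eq_axis)
  have "(Basis :: ('a ^ 'n) set) = (\<lambda>(k, u). axis k u) ` (UNIV \<times> Basis)"
    by (auto simp: Basis_vec_def)
  then have "(\<Prod>b\<in>Basis. f b) = (\<Prod>b\<in>(\<lambda>(k, u). axis k u) ` (UNIV \<times> Basis). f b)"
    by (simp only:)
  also have "\<dots> = (\<Prod>k\<in>UNIV. \<Prod>u\<in>Basis. f (axis k u))"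
    by (subst prod.reindex[OF inj]) (simp add: prod.cartesian_product case_prod_unfold comp_def)
  finally show ?thesis .
qed

lemma lborel_vec:
  "(lborel :: ('a::euclidean_space ^ 'n) measure) = distr (Pi\<^sub>M UNIV (\<lambda>_. lborel)) borel (\<lambda>x. \<chi> k. x k)"
proof (rule lborel_eqI)
  interpret product_sigma_finite "\<lambda>_::'n. lborel :: 'a measure" ..
  fix l u :: "'a ^ 'n"
  assume le: "\<And>b. b \<in> Basis \<Longrightarrow> l \<bullet> b \<le> u \<bullet> b"
  have le': "l $ k \<bullet> b \<le> u $ k \<bullet> b" if "b \<in> Basis" for k b
    using le[of "axis k b"] that by (auto simp: Basis_vec_def inner_axis)
  have "(\<lambda>x. \<chi> k. x k) -` box l u \<inter> space (Pi\<^sub>M UNIV (\<lambda>_. lborel)) = (\<Pi>\<^sub>E k\<in>UNIV. box (l $ k) (u $ k))"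
    by (auto simp: box_def Basis_vec_def inner_axis space_PiM)
  then have "emeasure (distr (Pi\<^sub>M UNIV (\<lambda>_. lborel)) borel (\<lambda>x. \<chi> k. x k)) (box l u)
      = (\<Prod>k\<in>UNIV. emeasure lborel (box (l $ k) (u $ k)))"
    by (subst emeasure_distr) (auto simp: emeasure_PiM cong: measurable_cong_sets)
  also have "\<dots> = ennreal (\<Prod>b\<in>Basis. (u - l) \<bullet> b)"
    using le' by (simp add: emeasure_lborel_box_eq prod_ennreal prod_nonneg prod_over_Basis_vec inner_axis inner_diff_left)
  finally show "emeasure (distr (Pi\<^sub>M UNIV (\<lambda>_. lborel)) borel (\<lambda>x. \<chi> k. x k)) (box l u)
      = ennreal (\<Prod>b\<in>Basis. (u - l) \<bullet> b)" .
qed simp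

text \<open>The common form of the two measures of interest: with \<open>w\<close> the normalized indicator of
  \<open>{0..2*pi}\<close> and \<open>\<phi> = cis\<close> it gives the torus, with the disc weight and the identity
  it gives the polydisc.\<close>
lemma nn_integral_product_density:
  fixes w :: "'a::euclidean_space \<Rightarrow> ennreal" and \<phi> :: "'a \<Rightarrow> 'b::topological_space"
    and F :: "('n::finite \<Rightarrow> 'b) \<Rightarrow> ennreal"
  defines "M \<equiv> distr (density lborel w) borel \<phi>"
  assumes [measurable]: "w \<in> borel_measurable borel" "\<phi> \<in> borel_measurable borel"
    "F \<in> borel_measurable (Pi\<^sub>M UNIV (\<lambda>_. borel))"
    and M: "sigma_finite_measure M"
  shows "(\<integral>\<^sup>+z. (\<Prod>k\<in>UNIV. w (z $ k)) * F (\<lambda>k. \<phi> (z $ k)) \<partial>lborel) = (\<integral>\<^sup>+x. F x \<partial>Pi\<^sub>M UNIV (\<lambda>_. M))"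
proof -
  interpret L: product_sigma_finite "\<lambda>_::'n. lborel :: 'a measure" ..
  interpret P: product_sigma_finite "\<lambda>_::'n. M" by (rule product_sigma_finite.intro) (rule M)
  have [measurable]: "(\<lambda>(z::'a ^ 'n) k. \<phi> (z $ k)) \<in> borel \<rightarrow>\<^sub>M Pi\<^sub>M UNIV (\<lambda>_. borel)"
    by (rule measurable_abs_UNIV) measurable
  let ?P = "distr (density lborel (\<lambda>z. \<Prod>k\<in>UNIV. w (z $ k))) (Pi\<^sub>M UNIV (\<lambda>_. borel)) (\<lambda>(z::'a ^ 'n) k. \<phi> (z $ k))"
  have "?P = Pi\<^sub>M UNIV (\<lambda>_. M)"
  proof (rule P.PiM_eqI)
    show "sets ?P = sets (Pi\<^sub>M UNIV (\<lambda>_. M))"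
      by (simp add: M_def cong: sets_PiM_cong)
    fix S :: "'n \<Rightarrow> 'b set" assume "\<And>k. k \<in> UNIV \<Longrightarrow> S k \<in> sets M"
    then have [measurable]: "\<And>k. S k \<in> sets borel" by (simp add: M_def)
    have "emeasure ?P (Pi\<^sub>E UNIV S)
        = (\<integral>\<^sup>+z. (\<Prod>k\<in>UNIV. w (z $ k)) * indicator (Pi\<^sub>E UNIV S) (\<lambda>k. \<phi> (z $ k)) \<partial>lborel)"
      by (simp add: nn_integral_distr nn_integral_density flip: nn_integral_indicator)
    also have "\<dots> = (\<integral>\<^sup>+z. (\<Prod>k\<in>UNIV. w (z $ k) * indicator (S k) (\<phi> (z $ k))) \<partial>(lborel :: ('a ^ 'n) measure))"
    proof (rule nn_integral_cong)
      fix z :: "'a ^ 'n"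
      have "(indicator (Pi\<^sub>E UNIV S) (\<lambda>k. \<phi> (z $ k)) :: ennreal) = (\<Prod>k\<in>UNIV. indicator (S k) (\<phi> (z $ k)))"
        by (auto simp: indicator_def PiE_iff)
      then show "(\<Prod>k\<in>UNIV. w (z $ k)) * indicator (Pi\<^sub>E UNIV S) (\<lambda>k. \<phi> (z $ k))
          = (\<Prod>k\<in>UNIV. w (z $ k) * indicator (S k) (\<phi> (z $ k)))"
        by (simp add: prod.distrib)
    qed
    also have "\<dots> = (\<integral>\<^sup>+x. (\<Prod>k\<in>UNIV. w (x k) * indicator (S k) (\<phi> (x k))) \<partial>Pi\<^sub>M UNIV (\<lambda>_. lborel))"
      by (subst lborel_vec, subst nn_integral_distr) (auto cong: measurable_cong_sets)
    also have "\<dots> = (\<Prod>k\<in>UNIV. \<integral>\<^sup>+x. w x * indicator (S k) (\<phi> x) \<partial>lborel)"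
      by (rule L.product_nn_integral_prod) auto
    also have "\<dots> = (\<Prod>k\<in>UNIV. emeasure M (S k))"
      by (simp add: M_def nn_integral_distr nn_integral_density flip: nn_integral_indicator)
    finally show "emeasure ?P (Pi\<^sub>E UNIV S) = (\<Prod>k\<in>UNIV. emeasure M (S k))" .
  qed simp
  then have "(\<integral>\<^sup>+x. F x \<partial>Pi\<^sub>M UNIV (\<lambda>_. M)) = (\<integral>\<^sup>+x. F x \<partial>?P)" by simp
  also have "\<dots> = (\<integral>\<^sup>+z. (\<Prod>k\<in>UNIV. w (z $ k)) * F (\<lambda>k. \<phi> (z $ k)) \<partial>lborel)"
    by (subst nn_integral_distr, simp, simp, subst nn_integral_density) auto
  finally show ?thesis by simp
qed

section \<open>The inequality on the polydisc\<close>

lemma sigma_finite_circle_measure: "sigma_finite_measure circle_measure"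
  using finite_circle_measure by (rule finite_measure.axioms(1))

lemma sigma_finite_disc_measure: "m \<ge> 2 \<Longrightarrow> sigma_finite_measure (disc_measure m)"
  using finite_disc_measure by (blast dest: finite_measure.axioms(1))

lemma nn_integral_torus_measure:
  fixes G :: "complex ^ 'n \<Rightarrow> ennreal"
  assumes [measurable]: "G \<in> borel_measurable borel"
  shows "(\<integral>\<^sup>+w. G w \<partial>torus_measure) = (\<integral>\<^sup>+x. G (\<chi> k. x k) \<partial>Pi\<^sub>M UNIV (\<lambda>_. circle_measure))"
proof -
  let ?Q = "cbox 0 (\<chi> k. 2*pi) :: (real ^ 'n) set"
  let ?w = "\<lambda>t. ennreal (indicator {0..2*pi} t / (2*pi))"
  have [measurable]: "(\<lambda>t::real^'n. \<chi> k. cis (t $ k)) \<in> borel \<rightarrow>\<^sub>M borel"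
    unfolding cis_conv_exp by (intro borel_measurable_continuous_onI continuous_intros)
  have Q: "emeasure lborel ?Q = ennreal ((2*pi) ^ CARD('n))"
  proof -
    have "emeasure lborel ?Q = ennreal (\<Prod>b\<in>Basis. ((\<chi> k. 2*pi) - 0) \<bullet> (b :: real ^ 'n))"
      by (rule emeasure_lborel_cbox) (auto simp: Basis_vec_def inner_axis)
    also have "(\<Prod>b\<in>Basis. ((\<chi> k. 2*pi) - 0) \<bullet> (b :: real ^ 'n)) = (2*pi) ^ CARD('n)"
      unfolding prod_over_Basis_vec by (simp add: inner_axis)
    finally show ?thesis .
  qed
  have weight: "indicator ?Q t / emeasure lborel ?Q = (\<Prod>k\<in>UNIV. ?w (t $ k))" for t :: "real ^ 'n"
  proof (cases "t \<in> ?Q")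
    case True
    then have "t $ k \<in> {0..2*pi}" for k by (simp add: mem_box_cart)
    then have "(\<Prod>k\<in>UNIV. ?w (t $ k)) = ennreal ((1 / (2*pi)) ^ CARD('n))"
      by (simp add: ennreal_power)
    then show ?thesis using True unfolding Q
      by (simp add: divide_ennreal power_one_over flip: ennreal_1)
  next
    case False
    then obtain k where "t $ k \<notin> {0..2*pi}" by (auto simp: mem_box_cart)
    then have "?w (t $ k) = 0" by simp
    then have "(\<Prod>k\<in>UNIV. ?w (t $ k)) = 0" by (intro prod_zero) auto
    then show ?thesis using False by simp
  qed
  have map: "(\<lambda>t. \<chi> k. cis (t $ k)) \<in> uniform_measure lborel ?Q \<rightarrow>\<^sub>M restrict_space borel torus"
    by (rule measurable_restrict_space2) (auto simp: torus_def)
  have "(\<integral>\<^sup>+w. G w \<partial>torus_measure) = (\<integral>\<^sup>+t. G (\<chi> k. cis (t $ k)) \<partial>uniform_measure lborel ?Q)"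
    unfolding torus_measure_def by (rule nn_integral_distr[OF map]) (simp add: measurable_restrict_space1)
  also have "\<dots> = (\<integral>\<^sup>+t. (\<Prod>k\<in>UNIV. ?w (t $ k)) * G (\<chi> k. cis (t $ k)) \<partial>lborel)"
    unfolding uniform_measure_def by (subst nn_integral_density) (auto simp: weight)
  also have "\<dots> = (\<integral>\<^sup>+x. G (\<chi> k. x k) \<partial>Pi\<^sub>M UNIV (\<lambda>_. circle_measure))"
    using nn_integral_product_density[of ?w cis "\<lambda>x. G (\<chi> k. x k)"] sigma_finite_circle_measure
    by (simp add: circle_measure_def)
  finally show ?thesis .
qed

lemma open_polydisc: "open (polydisc :: (complex ^ 'n) set)"
proof -
  have "polydisc = (\<Inter>k. {z :: complex ^ 'n. norm (z $ k) < 1})" by (auto simp: polydisc_def)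
  also have "open \<dots>" by (intro open_INT ballI open_Collect_less continuous_intros) auto
  finally show ?thesis .
qed

lemma nn_integral_bergman_measure:
  fixes G :: "complex ^ 'n \<Rightarrow> ennreal"
  assumes m: "m \<ge> 2" and [measurable]: "G \<in> borel_measurable borel"
  shows "(\<integral>\<^sup>+z. G z \<partial>bergman_measure m) = (\<integral>\<^sup>+x. G (\<chi> k. x k) \<partial>Pi\<^sub>M UNIV (\<lambda>_. disc_measure m))"
proof -
  let ?W = "\<lambda>z :: complex ^ 'n. ennreal ((real m - 1) ^ CARD('n) / pi ^ CARD('n) *
                     (\<Prod>k\<in>UNIV. (1 - (norm (z $ k))\<^sup>2) ^ (m - 2)))"
  have [measurable]: "polydisc \<in> sets (borel :: (complex ^ 'n) measure)"
    using open_polydisc by (rule borel_open)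
  have weight: "?W z * G z * indicator polydisc z = (\<Prod>k\<in>UNIV. disc_weight m (z $ k)) * G z" for z :: "complex ^ 'n"
  proof (cases "z \<in> polydisc")
    case True
    then have z: "norm (z $ k) < 1" for k by (simp add: polydisc_def)
    have "(\<Prod>k\<in>UNIV. disc_weight m (z $ k))
        = (\<Prod>k\<in>UNIV. ennreal ((real m - 1) / pi * (1 - (norm (z $ k))\<^sup>2) ^ (m - 2)))"
      using z by (simp add: disc_weight_def)
    also have "\<dots> = ennreal (\<Prod>k\<in>UNIV. (real m - 1) / pi * (1 - (norm (z $ k))\<^sup>2) ^ (m - 2))"
      using m z by (intro prod_ennreal) (auto simp: power_le_one less_imp_le)
    also have "\<dots> = ?W z" by (simp only: prod.distrib prod_constant power_divide)
    finally show ?thesis using True by simp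
  next
    case False
    then obtain k where "\<not> norm (z $ k) < 1" by (auto simp: polydisc_def)
    then have "disc_weight m (z $ k) = 0" by (simp add: disc_weight_def)
    then have "(\<Prod>k\<in>UNIV. disc_weight m (z $ k)) = 0" by (intro prod_zero) auto
    then show ?thesis using False by simp
  qed
  have "(\<integral>\<^sup>+z. G z \<partial>bergman_measure m) = (\<integral>\<^sup>+z. ?W z * G z \<partial>restrict_space lborel polydisc)"
    unfolding bergman_measure_def
    by (rule nn_integral_density) (auto intro!: measurable_restrict_space1)
  also have "\<dots> = (\<integral>\<^sup>+z. (\<Prod>k\<in>UNIV. disc_weight m (z $ k)) * G z \<partial>lborel)"
    by (subst nn_integral_restrict_space) (simp_all only: weight, simp)
  also have "\<dots> = (\<integral>\<^sup>+x. G (\<chi> k. x k) \<partial>Pi\<^sub>M UNIV (\<lambda>_. disc_measure m))"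
  proof -
    have eq: "distr (density lborel (disc_weight m)) borel (\<lambda>z. z) = disc_measure m"
      unfolding disc_measure_def by (rule distr_id2) simp
    show ?thesis
      using nn_integral_product_density[of "disc_weight m" "\<lambda>z. z" "\<lambda>x. G (\<chi> k. x k)"]
        sigma_finite_disc_measure[OF m]
      by (simp add: eq)
  qed
  finally show ?thesis .
qed

lemma space_bergman_measure: "space (bergman_measure m) = polydisc"
  by (simp add: bergman_measure_def space_restrict_space)

lemma space_torus_measure: "space torus_measure = torus"
  by (simp add: torus_measure_def space_restrict_space)

text \<open>Complex linearity of the derivative makes its restriction to a coordinate direction
  multiplication by a complex number.\<close>
lemma holomorphic_vec_on_slice:
  fixes f :: "complex ^ 'n \<Rightarrow> complex" and v :: "complex ^ 'n"
  assumes f: "holomorphic_vec_on f polydisc" and S: "open S"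
    and v: "\<And>y. y \<in> S \<Longrightarrow> (\<chi> k. if k = i then c * y else v $ k) \<in> polydisc"
  shows "(\<lambda>y. f (\<chi> k. if k = i then c * y else v $ k)) holomorphic_on S"
  unfolding holomorphic_on_open[OF S]
proof (intro allI impI ballI)
  fix y assume y: "y \<in> S"
  let ?e = "\<lambda>y. \<chi> k. if k = i then c * y else v $ k"
  obtain D where D: "(f has_derivative D) (at (?e y) within polydisc)" "\<And>c v. D (c *s v) = c * D v"
    using f v[OF y] unfolding holomorphic_vec_on_def by blast
  have "(f has_derivative D) (at (?e y))"
    using D(1) unfolding at_within_open[OF v[OF y] open_polydisc] .
  moreover have "(?e has_derivative (\<lambda>h. (c * h) *s axis i 1)) (at y)"
  proof -
    have "bounded_linear (\<lambda>h. (c * h) *s (axis i 1 :: complex ^ 'n))"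
      by (intro linear_conv_bounded_linear[THEN iffD1] linearI)
         (simp_all add: vec_eq_iff distrib_left distrib_right)
    then have "((\<lambda>y. (c * y) *s axis i 1) has_derivative (\<lambda>h. (c * h) *s (axis i 1 :: complex ^ 'n))) (at y)"
      by (rule bounded_linear_imp_has_derivative)
    then have "((\<lambda>y. (c * y) *s axis i 1 + (\<chi> k. if k = i then 0 else v $ k)) has_derivative
        (\<lambda>h. (c * h) *s (axis i 1 :: complex ^ 'n))) (at y)"
      using has_derivative_add_const by blast
    moreover have "(\<lambda>y. (c * y) *s axis i 1 + (\<chi> k. if k = i then 0 else v $ k)) = ?e"
      by (auto simp: vec_eq_iff axis_def)
    ultimately show ?thesis by simp
  qed
  ultimately have "((\<lambda>y. f (?e y)) has_derivative (\<lambda>h. D ((c * h) *s axis i 1))) (at y)"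
    using has_derivative_compose[of ?e _ y UNIV f D] by simp
  then have "((\<lambda>y. f (?e y)) has_field_derivative c * D (axis i 1)) (at y)"
    unfolding has_field_derivative_def D(2) by (simp add: mult_ac mult_commute_abs)
  then show "\<exists>f'. ((\<lambda>y. f (?e y)) has_field_derivative f') (at y)" by blast
qed

lemma holomorphic_vec_on_continuous:
  "holomorphic_vec_on f S \<Longrightarrow> continuous_on S f"
  unfolding holomorphic_vec_on_def continuous_on_eq_continuous_within
  using has_derivative_continuous by blast

text \<open>The integrand of the polydisc inequality for the dilated function. The retraction in each
  coordinate makes it continuous everywhere and agrees with the identity on the closed polydisc.\<close>
definition dilated_modulus :: "real \<Rightarrow> real \<Rightarrow> (complex ^ 'n \<Rightarrow> complex) \<Rightarrow> ('n \<Rightarrow> complex) \<Rightarrow> ennreal" where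
  "dilated_modulus p r f x = ennreal (norm (f (r *\<^sub>R (\<chi> k. disc_retraction (x k)))) powr p)"

lemma scaleR_in_polydisc:
  assumes "0 < r" "r < 1" "\<And>k. norm (z $ k) \<le> 1"
  shows "r *\<^sub>R z \<in> polydisc"
  unfolding polydisc_def
proof (intro CollectI allI)
  fix k
  have "r * norm (z $ k) \<le> r * 1" using assms by (intro mult_left_mono) auto
  then have "r * norm (z $ k) < 1" using assms(2) by linarith
  then show "norm ((r *\<^sub>R z) $ k) < 1" using assms(1) by simp
qed

lemma continuous_dilated:
  fixes f :: "complex ^ 'n \<Rightarrow> complex"
  assumes f: "holomorphic_vec_on f polydisc" and r: "0 < r" "r < 1"
  shows "continuous_on UNIV (\<lambda>z. f (r *\<^sub>R (\<chi> k. disc_retraction (z $ k))))"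
proof (rule continuous_on_compose2[OF holomorphic_vec_on_continuous[OF f]])
  show "continuous_on UNIV (\<lambda>z :: complex ^ 'n. r *\<^sub>R (\<chi> k. disc_retraction (z $ k)))"
    by (intro continuous_intros continuous_on_compose2[OF continuous_disc_retraction[of UNIV]]) auto
  show "(\<lambda>z :: complex ^ 'n. r *\<^sub>R (\<chi> k. disc_retraction (z $ k))) ` UNIV \<subseteq> polydisc"
    using r by (auto intro!: scaleR_in_polydisc norm_disc_retraction)
qed

lemma dilated_modulus_measurable:
  fixes f :: "complex ^ 'n \<Rightarrow> complex"
  assumes "holomorphic_vec_on f polydisc" "0 < r" "r < 1"
  shows "(\<lambda>z. dilated_modulus p r f (vec_nth z)) \<in> borel_measurable borel"
proof -
  have [measurable]: "(\<lambda>z. f (r *\<^sub>R (\<chi> k. disc_retraction (z $ k)))) \<in> borel_measurable borel"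
    by (rule borel_measurable_continuous_onI[OF continuous_dilated[OF assms]])
  show ?thesis unfolding dilated_modulus_def by measurable
qed

text \<open>A slice of the dilated function extends holomorphically to the disc of radius \<open>1 / r\<close>,
  whatever the other coordinates are, because the retraction keeps them in the closed disc.\<close>
lemma dilated_modulus_slice:
  fixes f :: "complex ^ 'n \<Rightarrow> complex"
  assumes f: "holomorphic_vec_on f polydisc" and r: "0 < r" "r < 1"
  shows "(\<lambda>y. dilated_modulus p r f (x(i := y))) \<in> hardy_type p"
proof -
  define h where "h y = f (\<chi> k. if k = i then of_real r * y else (r *\<^sub>R (\<chi> k. disc_retraction (x k))) $ k)" for y
  have "h holomorphic_on ball 0 (1 / r)"
    unfolding h_def
  proof (rule holomorphic_vec_on_slice[OF f open_ball])
    fix y :: complex assume "y \<in> ball 0 (1 / r)"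
    then have "r * norm y < 1" using r by (simp add: field_simps)
    moreover have "r * norm (disc_retraction z) < 1" for z
      using mult_left_mono[OF norm_disc_retraction[of z], of r] r by linarith
    ultimately show "(\<chi> k. if k = i then of_real r * y else (r *\<^sub>R (\<chi> k. disc_retraction (x k))) $ k) \<in> polydisc"
      using r by (simp add: polydisc_def norm_mult)
  qed
  moreover have "dilated_modulus p r f (x(i := y)) = ennreal (norm (h y) powr p)" if "norm y \<le> 1" for y
  proof -
    have "r *\<^sub>R (\<chi> k. disc_retraction ((x(i := y)) k))
        = (\<chi> k. if k = i then of_real r * y else (r *\<^sub>R (\<chi> k. disc_retraction (x k))) $ k)"
      using that by (auto simp: vec_eq_iff disc_retraction_id scaleR_conv_of_real[where 'a = complex])
    then show ?thesis by (simp add: dilated_modulus_def h_def)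
  qed
  moreover have "1 / r > 1" using r by simp
  ultimately show ?thesis unfolding hardy_type_def by blast
qed

text \<open>The one-variable inequality, tensorized over the coordinates. The torus integrals
  that arise are means over the torus of radius \<open>r\<close>, hence at most the Hardy means.\<close>
lemma dilated_inequality:
  fixes f :: "nat \<Rightarrow> complex ^ 'n \<Rightarrow> complex"
  assumes m: "m \<ge> 2" and p: "p > 0" and f: "\<And>j. j < m \<Longrightarrow> holomorphic_vec_on (f j) polydisc"
    and r: "0 < r" "r < 1"
  shows "(\<integral>\<^sup>+z. (\<Prod>j<m. ennreal (norm (f j (r *\<^sub>R z)) powr p)) \<partial>bergman_measure m)
     \<le> (\<Prod>j<m. hardy_mean p (f j))"
proof -
  have [measurable]: "(\<lambda>z. dilated_modulus p r (f j) (vec_nth z)) \<in> borel_measurable borel" if "j < m" for j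
    by (rule dilated_modulus_measurable[OF f[OF that] r])
  have meas: "dilated_modulus p r (f j) \<in> borel_measurable (Pi\<^sub>M UNIV (\<lambda>_. borel))" if "j < m" for j
    using measurable_compose[OF measurable_vec_lambda dilated_modulus_measurable[OF f[OF that] r]]
    by (simp add: vec_lambda_inverse)
  have eq: "dilated_modulus p r g (vec_nth z) = ennreal (norm (g (r *\<^sub>R z)) powr p)"
    if "\<And>k. norm (z $ k) \<le> 1" for g :: "complex ^ 'n \<Rightarrow> complex" and z
    using that by (simp add: dilated_modulus_def disc_retraction_id)
  have "(\<integral>\<^sup>+z. (\<Prod>j<m. ennreal (norm (f j (r *\<^sub>R z)) powr p)) \<partial>bergman_measure m)
      = (\<integral>\<^sup>+z. (\<Prod>j<m. dilated_modulus p r (f j) (vec_nth z)) \<partial>bergman_measure m)"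
    by (rule nn_integral_cong) (simp add: space_bergman_measure polydisc_def eq less_imp_le)
  also have "\<dots> = (\<integral>\<^sup>+x. (\<Prod>j<m. dilated_modulus p r (f j) x) \<partial>Pi\<^sub>M UNIV (\<lambda>_. disc_measure m))"
    by (subst nn_integral_bergman_measure[OF m]) (simp_all add: vec_lambda_inverse)
  also have "\<dots> \<le> (\<Prod>j<m. \<integral>\<^sup>+x. dilated_modulus p r (f j) x \<partial>Pi\<^sub>M UNIV (\<lambda>_. circle_measure))"
  proof (rule product_inequality_tensorizes[where C = "hardy_type p"])
    show "(\<lambda>y. dilated_modulus p r (f j) (x(i := y))) \<in> hardy_type p" if "j \<in> {..<m}" for j i x
      using that by (intro dilated_modulus_slice f r) auto
  qed (use m sigma_finite_disc_measure sigma_finite_circle_measure meas Bergman_Hardy_inequality_one_variable[OF m p] in auto)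
  also have "\<dots> \<le> (\<Prod>j<m. hardy_mean p (f j))"
  proof (rule prod_mono_ennreal)
    fix j assume "j \<in> {..<m}"
    then have j: "j < m" by simp
    have "(\<integral>\<^sup>+x. dilated_modulus p r (f j) x \<partial>Pi\<^sub>M UNIV (\<lambda>_. circle_measure))
        = (\<integral>\<^sup>+w. dilated_modulus p r (f j) (vec_nth w) \<partial>torus_measure)"
      using j by (subst nn_integral_torus_measure) (simp_all add: vec_lambda_inverse)
    also have "\<dots> = (\<integral>\<^sup>+w. ennreal (norm (f j (r *\<^sub>R w)) powr p) \<partial>torus_measure)"
      by (rule nn_integral_cong) (simp add: space_torus_measure torus_def eq)
    also have "\<dots> \<le> hardy_mean p (f j)"
      unfolding hardy_mean_def using r by (intro SUP_upper) auto
    finally show "(\<integral>\<^sup>+x. dilated_modulus p r (f j) x \<partial>Pi\<^sub>M UNIV (\<lambda>_. circle_measure)) \<le> hardy_mean p (f j)" .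
  qed
  finally show ?thesis .
qed

text \<open>Fatou's lemma along dilations by \<open>s n\<close> tending to one; the bound does not depend on
  the dilation.\<close>
lemma bergman_integral_product_le:
  fixes f :: "nat \<Rightarrow> complex ^ 'n \<Rightarrow> complex"
  assumes m: "m \<ge> 2" and p: "p > 0" and f: "\<And>j. j < m \<Longrightarrow> holomorphic_vec_on (f j) polydisc"
  shows "bergman_integral m p (product_operator m f) \<le> (\<Prod>j<m. hardy_mean p (f j))"
proof -
  define s where "s n = 1 - inverse (real (Suc (Suc n)))" for n
  have s: "0 < s n" "s n < 1" for n by (auto simp: s_def field_simps)
  have s_lim: "s \<longlonglongrightarrow> 1"
    using LIMSEQ_Suc[OF LIMSEQ_inverse_real_of_nat_add_minus[of 1]] by (simp add: s_def[abs_def])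
  let ?u = "\<lambda>n z. \<Prod>j<m. dilated_modulus p (s n) (f j) (vec_nth z)"
  have eq: "?u n z = (\<Prod>j<m. ennreal (norm (f j (s n *\<^sub>R z)) powr p))" if "z \<in> polydisc" for n z
    using that by (simp add: dilated_modulus_def disc_retraction_id polydisc_def less_imp_le)
  have lim: "(\<lambda>n. ?u n z) \<longlonglongrightarrow> ennreal (norm (product_operator m f z) powr p)" if z: "z \<in> polydisc" for z
  proof -
    have "(\<lambda>n. norm (f j (s n *\<^sub>R z)) powr p) \<longlonglongrightarrow> norm (f j z) powr p" if "j < m" for j
    proof -
      have "isCont (f j) z"
        using holomorphic_vec_on_continuous[OF f[OF that]] z
        unfolding continuous_on_eq_continuous_at[OF open_polydisc] by blast
      moreover have "(\<lambda>n. s n *\<^sub>R z) \<longlonglongrightarrow> z"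
        using tendsto_scaleR[OF s_lim tendsto_const[of z]] by simp
      ultimately have "(\<lambda>n. f j (s n *\<^sub>R z)) \<longlonglongrightarrow> f j z"
        by (rule isCont_tendsto_compose)
      then show ?thesis using p by (intro tendsto_powr' tendsto_norm tendsto_const) auto
    qed
    then have "(\<lambda>n. ennreal (\<Prod>j<m. norm (f j (s n *\<^sub>R z)) powr p)) \<longlonglongrightarrow> ennreal (\<Prod>j<m. norm (f j z) powr p)"
      by (intro tendsto_ennrealI tendsto_prod) auto
    then show ?thesis
      using z by (simp add: eq prod_ennreal product_operator_def prod_powr_distrib flip: prod_norm)
  qed
  have "bergman_integral m p (product_operator m f) = (\<integral>\<^sup>+z. liminf (\<lambda>n. ?u n z) \<partial>bergman_measure m)"
    unfolding bergman_integral_def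
    by (rule nn_integral_cong) (simp add: space_bergman_measure lim_imp_Liminf[OF _ lim])
  also have "\<dots> \<le> liminf (\<lambda>n. \<integral>\<^sup>+z. ?u n z \<partial>bergman_measure m)"
  proof (rule nn_integral_liminf)
    fix n
    have "?u n \<in> borel_measurable borel"
      by (intro borel_measurable_prod_ennreal dilated_modulus_measurable f s) auto
    then show "?u n \<in> borel_measurable (bergman_measure m)"
      by (simp add: bergman_measure_def measurable_restrict_space1)
  qed
  also have "\<dots> \<le> liminf (\<lambda>n. \<Prod>j<m. hardy_mean p (f j))"
  proof (intro Liminf_mono always_eventually allI)
    fix n
    have "(\<integral>\<^sup>+z. ?u n z \<partial>bergman_measure m)
        = (\<integral>\<^sup>+z. (\<Prod>j<m. ennreal (norm (f j (s n *\<^sub>R z)) powr p)) \<partial>bergman_measure m)"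
      by (rule nn_integral_cong) (simp add: space_bergman_measure eq)
    then show "(\<integral>\<^sup>+z. ?u n z \<partial>bergman_measure m) \<le> (\<Prod>j<m. hardy_mean p (f j))"
      using dilated_inequality[OF m p f s] by simp
  qed
  also have "\<dots> = (\<Prod>j<m. hardy_mean p (f j))" by (simp add: Liminf_const)
  finally show ?thesis .
qed

section \<open>The product operator and its norm\<close>

lemma holomorphic_vec_on_const: "holomorphic_vec_on (\<lambda>_. c) S"
  unfolding holomorphic_vec_on_def by (auto intro!: exI[of _ "\<lambda>_. 0"])

lemma holomorphic_vec_on_mult:
  assumes "holomorphic_vec_on f S" "holomorphic_vec_on g S"
  shows "holomorphic_vec_on (\<lambda>z. f z * g z) S"
  unfolding holomorphic_vec_on_def
proof
  fix z assume z: "z \<in> S"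
  obtain D where D: "(f has_derivative D) (at z within S)" "\<And>c v. D (c *s v) = c * D v"
    using assms(1) z unfolding holomorphic_vec_on_def by blast
  obtain E where E: "(g has_derivative E) (at z within S)" "\<And>c v. E (c *s v) = c * E v"
    using assms(2) z unfolding holomorphic_vec_on_def by blast
  show "\<exists>D. ((\<lambda>z. f z * g z) has_derivative D) (at z within S) \<and> (\<forall>c v. D (c *s v) = c * D v)"
    using has_derivative_mult[OF D(1) E(1)] D(2) E(2)
    by (intro exI[of _ "\<lambda>h. f z * E h + D h * g z"]) (auto simp: algebra_simps)
qed

lemma holomorphic_vec_on_product_operator:
  assumes "\<And>j. j < m \<Longrightarrow> holomorphic_vec_on (f j) S"
  shows "holomorphic_vec_on (product_operator m f) S"
  using assms unfolding product_operator_def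
  by (induction m) (auto intro: holomorphic_vec_on_const holomorphic_vec_on_mult)

lemma product_operator_update:
  assumes "i < m"
  shows "product_operator m (f(i := g)) z = g z * (\<Prod>j\<in>{..<m} - {i}. f j z)"
proof -
  have "product_operator m (f(i := g)) z = g z * (\<Prod>j\<in>{..<m} - {i}. (f(i := g)) j z)"
    unfolding product_operator_def using assms by (subst prod.remove[of _ i]) auto
  also have "(\<Prod>j\<in>{..<m} - {i}. (f(i := g)) j z) = (\<Prod>j\<in>{..<m} - {i}. f j z)"
    by (rule prod.cong) auto
  finally show ?thesis .
qed

lemma product_operator_bergman_bound:
  assumes m: "m \<ge> 2" and p: "p > 0" and f: "\<And>j. j < m \<Longrightarrow> f j \<in> hardy_space p"
  shows "bergman_integral m p (product_operator m f) \<le> (\<Prod>j<m. hardy_mean p (f j))"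
    and "(\<Prod>j<m. hardy_mean p (f j)) < \<infinity>"
proof -
  show "bergman_integral m p (product_operator m f) \<le> (\<Prod>j<m. hardy_mean p (f j))"
    by (rule bergman_integral_product_le[OF m p]) (use f in \<open>auto simp: hardy_space_def\<close>)
  have "hardy_mean p (f j) \<noteq> top" if "j < m" for j
    using f[OF that] by (auto simp: hardy_space_def)
  then have "(\<Prod>j<m. hardy_mean p (f j)) \<noteq> top"
    by (auto simp: ennreal_prod_eq_top)
  then show "(\<Prod>j<m. hardy_mean p (f j)) < \<infinity>"
    by (simp add: less_top)
qed

lemma polylinear_product_operator:
  assumes m: "m \<ge> 2" and p: "p > 0"
  shows "polylinear_operator m (hardy_space p :: (complex ^ 'n \<Rightarrow> complex) set)
    (bergman_space m p) (product_operator m)"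
  unfolding polylinear_operator_def
proof (intro conjI allI impI)
  fix f :: "nat \<Rightarrow> complex ^ 'n \<Rightarrow> complex"
  assume "\<forall>j<m. f j \<in> hardy_space p"
  then have f: "\<And>j. j < m \<Longrightarrow> f j \<in> hardy_space p" by blast
  have "holomorphic_vec_on (product_operator m f) polydisc"
    by (rule holomorphic_vec_on_product_operator) (use f in \<open>auto simp: hardy_space_def\<close>)
  moreover have "bergman_integral m p (product_operator m f) < \<infinity>"
    using product_operator_bergman_bound[OF m p f] by (rule le_less_trans)
  ultimately show "product_operator m f \<in> bergman_space m p"
    by (simp add: bergman_space_def)
next
  fix f :: "nat \<Rightarrow> complex ^ 'n \<Rightarrow> complex" and i and g h :: "complex ^ 'n \<Rightarrow> complex" and a b
  assume "(\<forall>j<m. f j \<in> hardy_space p) \<and> i < m \<and> g \<in> hardy_space p \<and> h \<in> hardy_space p"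
  then show "product_operator m (f(i := \<lambda>z. a * g z + b * h z)) =
          (\<lambda>z. a * product_operator m (f(i := g)) z + b * product_operator m (f(i := h)) z)"
    by (auto simp: product_operator_update algebra_simps)
qed

text \<open>If some Hardy norm vanishes, the quotient is zero by the convention for division by zero.\<close>
lemma product_norm_ratio_le_1:
  assumes m: "m \<ge> 2" and p: "p > 0" and f: "\<And>j. j < m \<Longrightarrow> f j \<in> hardy_space p"
  shows "bergman_norm m p (product_operator m f) / (\<Prod>j<m. hardy_norm p (f j)) \<le> 1"
proof -
  have "enn2real (bergman_integral m p (product_operator m f)) \<le> enn2real (\<Prod>j<m. hardy_mean p (f j))"
    using product_operator_bergman_bound[OF m p f] by (intro enn2real_mono) auto
  also have "\<dots> = (\<Prod>j<m. enn2real (hardy_mean p (f j)))"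
    by (induction m) (auto simp: enn2real_mult)
  finally have "bergman_norm m p (product_operator m f) \<le> (\<Prod>j<m. enn2real (hardy_mean p (f j))) powr (1 / p)"
    unfolding bergman_norm_def using p by (intro powr_mono2) auto
  also have "\<dots> = (\<Prod>j<m. hardy_norm p (f j))"
    unfolding hardy_norm_def by (rule prod_powr_distrib)
  finally have "bergman_norm m p (product_operator m f) \<le> (\<Prod>j<m. hardy_norm p (f j))" .
  moreover have "0 \<le> (\<Prod>j<m. hardy_norm p (f j))"
    by (intro prod_nonneg) (simp add: hardy_norm_def)
  ultimately show ?thesis
    by (intro divide_le_eq_1[THEN iffD2]) linarith
qed

lemma emeasure_PiM_space_1:
  fixes M :: "'b measure"
  assumes "emeasure M (space M) = 1"
  shows "emeasure (Pi\<^sub>M (UNIV :: 'n::finite set) (\<lambda>_. M)) (space (Pi\<^sub>M UNIV (\<lambda>_. M))) = 1"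
proof -
  interpret finite_measure M by (rule finite_measureI) (simp add: assms)
  interpret product_sigma_finite "\<lambda>_::'n. M" ..
  show ?thesis by (simp add: space_PiM emeasure_PiM assms)
qed

lemma hardy_mean_1: "hardy_mean p (\<lambda>_ :: complex ^ 'n. 1) = 1"
proof -
  have "(\<integral>\<^sup>+w. 1 \<partial>(torus_measure :: (complex ^ 'n) measure)) = 1"
    by (subst nn_integral_torus_measure)
       (simp_all add: emeasure_PiM_space_1 emeasure_circle_measure)
  then show ?thesis by (simp add: hardy_mean_def)
qed

lemma bergman_integral_1:
  assumes "m \<ge> 2"
  shows "bergman_integral m p (\<lambda>_ :: complex ^ 'n. 1) = 1"
proof -
  have "bergman_integral m p (\<lambda>_ :: complex ^ 'n. 1) = (\<integral>\<^sup>+z. 1 \<partial>(bergman_measure m :: (complex ^ 'n) measure))"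
    by (simp add: bergman_integral_def)
  also have "\<dots> = 1"
    by (subst nn_integral_bergman_measure[OF assms])
       (simp_all add: emeasure_PiM_space_1 emeasure_disc_measure assms)
  finally show ?thesis .
qed

theorem corollary1p4:
  fixes m :: nat and p :: real
  assumes "m \<ge> 2" and "p \<ge> 1"
  shows "polylinear_operator m (hardy_space p :: (complex ^ 'n \<Rightarrow> complex) set)
           (bergman_space m p) (product_operator m) \<and>
         hardy_bergman_operator_norm m p
           (product_operator m :: (nat \<Rightarrow> complex ^ 'n \<Rightarrow> complex) \<Rightarrow> complex ^ 'n \<Rightarrow> complex) = 1"
proof (intro conjI antisym)
  have p: "p > 0" using assms by simp
  show "polylinear_operator m (hardy_space p :: (complex ^ 'n \<Rightarrow> complex) set)
           (bergman_space m p) (product_operator m)"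
    using assms(1) p by (rule polylinear_product_operator)
  let ?B = "product_operator m :: (nat \<Rightarrow> complex ^ 'n \<Rightarrow> complex) \<Rightarrow> complex ^ 'n \<Rightarrow> complex"
  show "hardy_bergman_operator_norm m p ?B \<le> 1"
    unfolding hardy_bergman_operator_norm_def
    by (rule SUP_least) (use product_norm_ratio_le_1[OF assms(1) p] in \<open>auto simp: ennreal_le_1\<close>)
  let ?one = "\<lambda>(_::nat) (_ :: complex ^ 'n). 1 :: complex"
  have one: "?B ?one = (\<lambda>_. 1)" by (simp add: product_operator_def)
  have "?one j \<in> hardy_space p" for j
    by (simp add: hardy_space_def holomorphic_vec_on_const hardy_mean_1)
  moreover have "(0 :: complex ^ 'n) \<in> polydisc"
    by (simp add: polydisc_def)
  ultimately have mem: "?one \<in> {f. \<forall>j<m. f j \<in> hardy_space p \<and> (\<exists>z\<in>polydisc. f j z \<noteq> 0)}"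
    by fastforce
  have "1 = ennreal (bergman_norm m p (?B ?one) / (\<Prod>j<m. hardy_norm p (?one j)))"
    by (simp add: one bergman_norm_def hardy_norm_def hardy_mean_1 bergman_integral_1 assms(1))
  also have "\<dots> \<le> hardy_bergman_operator_norm m p ?B"
    unfolding hardy_bergman_operator_norm_def by (rule SUP_upper[OF mem])
  finally show "1 \<le> hardy_bergman_operator_norm m p ?B" .
qed

end
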